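(* For every fixed integer $k\ge 3$, $\operatorname{ex}_{\mathrm{tr}}(n,\mathrm{VD}_k)=O_k\bigl(n^{2^k-2k+1}\bigr)$; that is, there is a constant $C=C(k)$ such that for every $n\ge 1$, every hypergraph on $n$ vertices with no trace copy of $\mathrm{VD}_k$ has at most $C\,n^{2^k-2k+1}$ edges.
   Context: A hypergraph $H$ (no uniformity is assumed) is a finite vertex set $V(H)$ with a set system $E(H)\subseteq\mathcal P(V(H))$. For $S\subseteq V(H)$, the trace of $H$ on $S$ is the hypergraph on $S$ with edge set $H|_S=\{E\cap S:E\in E(H)\}$. $H$ contains a hypergraph $F$ as a trace (contains a trace copy of $F$) if $H|_S$ contains a subhypergraph isomorphic to $F$ for some $S\subseteq V(H)$. $\operatorname{ex}_{\mathrm{tr}}(n,F)$ denotes the maximum number of edges in an $n$-vertex hypergraph with no trace copy of $F$. The $k$-Venn diagram $\mathrm{VD}_k$ is the hypergraph with vertex set $2^{[k]}$ (all subsets of $[k]=\{1,\dots,k\}$) and $k$ edges $E_i=\{A\subseteq[k]: i\in A\}$, $i=1,\dots,k$. Its vertex $\emptyset$ lies in no edge but is part of the vertex set. Thus $H$ contains a trace copy of $\mathrm{VD}_k$ if and only if there are $k$ edges of $H$ for which all $2^k$ regions of their Venn diagram in $V(H)$ (including the region outside all of them) are non-empty. *)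

theory Defs
  imports Complex_Main "HOL-Library.Landau_Symbols"
begin

type_synonym 'a hypergraph = "'a set \<times> 'a set set"

abbreviation verts :: "'a hypergraph \<Rightarrow> 'a set" where
  "verts H \<equiv> fst H"

abbreviation edges :: "'a hypergraph \<Rightarrow> 'a set set" where
  "edges H \<equiv> snd H"

definition hypergraph :: "'a hypergraph \<Rightarrow> bool" where
  "hypergraph H \<longleftrightarrow> finite (verts H) \<and> edges H \<subseteq> Pow (verts H)"

definition trace :: "'a hypergraph \<Rightarrow> 'a set \<Rightarrow> 'a hypergraph" where
  "trace H S = (S, {E \<inter> S | E. E \<in> edges H})"

definition subhypergraph :: "'a hypergraph \<Rightarrow> 'a hypergraph \<Rightarrow> bool" where
  "subhypergraph G H \<longleftrightarrow> hypergraph G \<and> verts G \<subseteq> verts H \<and> edges G \<subseteq> edges H"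

definition hypergraph_iso :: "'a hypergraph \<Rightarrow> 'b hypergraph \<Rightarrow> bool" where
  "hypergraph_iso G H \<longleftrightarrow>
     (\<exists>f. bij_betw f (verts G) (verts H) \<and> edges H = (\<lambda>E. f ` E) ` edges G)"

definition contains_trace :: "'a hypergraph \<Rightarrow> 'b hypergraph \<Rightarrow> bool" where
  "contains_trace H F \<longleftrightarrow>
     (\<exists>S G. S \<subseteq> verts H \<and> subhypergraph G (trace H S) \<and> hypergraph_iso F G)"

text \<open>
  Vertices are natural numbers here. Every hypergraph has a finite vertex set, hence is
  isomorphic to one of this kind. The set below is finite; it can be empty only if
  already the edgeless hypergraph on \<open>n\<close> vertices contains \<open>F\<close> as a trace.
\<close>

definition ex_tr :: "nat \<Rightarrow> 'b hypergraph \<Rightarrow> nat" where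
  "ex_tr n F = Max {card (edges H) | H :: nat hypergraph.
     hypergraph H \<and> card (verts H) = n \<and> \<not> contains_trace H F}"

definition VD :: "nat \<Rightarrow> nat set hypergraph" where
  "VD k = (Pow {1..k}, {{A. A \<subseteq> {1..k} \<and> i \<in> A} | i. i \<in> {1..k}})"

end

theory Submission
  imports Defs
begin

text \<open>
  A hypergraph contains the \<open>k\<close>-Venn diagram as a trace iff it has \<open>k\<close> members with all \<open>2 ^ k\<close>
  Venn regions nonempty. So the question is how many sets on \<open>n\<close> points force \<open>k\<close> of them to have
  \<open>m\<close> nonempty regions. Three ideas answer it.

  \<^emph>\<open>Free vertices.\<close> Deleting a vertex \<open>v\<close> from a family \<open>H\<close> loses exactly as many sets as the link
  of \<open>v\<close> has, so a family with many more than \<open>n ^ (d + 1)\<close> sets has, after some deletions, a link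
  with many more than \<open>n ^ d\<close> sets. In \<open>k\<close> sets of the link the vertex \<open>v\<close> may be added or not,
  for each of them independently, so \<open>v\<close> can be put into any region that is still empty. Each
  further region therefore costs one factor \<open>n\<close> (\<open>poly_bdd_add_region\<close>).

  \<^emph>\<open>Cutting regions.\<close> Let \<open>k \<ge> 3\<close> and let \<open>k\<close> members of \<open>H\<close> have all \<open>2 ^ k\<close> regions. If another
  member cuts two of these regions, the \<open>k + 1\<close> sets have \<open>2 ^ k + 2\<close> regions. Otherwise every member
  is constant on all regions but one, so \<open>H\<close> is a union of families which live on fewer points, one
  for each region, and induction on the number of points bounds \<open>H\<close> (\<open>atom_recursion\<close>). The
  induction gains nothing only if all regions but one are single points. But then a member of the
  \<open>k\<close>-tuple, or its complement, has \<open>2 ^ (k - 1)\<close> elements, and what remains is a bound for uniform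
  families (\<open>reduction_to_uniform\<close>, \<open>uniform_has_regions\<close>). Hence \<open>k + 1\<close> sets with \<open>2 ^ k + 2\<close>
  regions are forced by the same power of \<open>n\<close> as \<open>k\<close> sets with \<open>2 ^ k\<close> regions. The missing
  \<open>2 ^ k - 2\<close> regions are filled by free vertices, and the exponent \<open>2 ^ k - 2 * k + 1\<close> satisfies
  just this recursion (\<open>poly_bdd_Venn_step\<close>).

  \<^emph>\<open>Three sets.\<close> For \<open>k = 3\<close> it remains to show that quadratically many sets force three of them to
  have seven regions; a free vertex gives the eighth. Let \<open>G\<close> be a smallest counterexample. By
  minimality all links are large: their sizes add up to at least about \<open>2 * card G\<close>. Three sets in
  the link of \<open>v\<close> have at most five regions, since with six the vertex \<open>v\<close> would supply a seventh. The
  recursion over regions, now for \<open>k = 2\<close>, shows that all but linearly many sets of the link have a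
  special form: they are \<^emph>\<open>branching\<close>, or their complements are. If \<open>Z\<close> is
  branching in the link of \<open>v\<close>, then \<open>Z\<close> has no other upper neighbour in \<open>G\<close> than \<open>insert v Z\<close>, the
  latter has none at all, and it has at most two lower neighbours of this kind. So there are at most
  \<open>2 / 3 * card G\<close> such pairs \<open>(v, Z)\<close> (\<open>card_up_edges\<close>), and as many for complements. Together
  this is less than the sum of the link sizes, a contradiction (\<open>poly_bdd_three_sets\<close>).
\<close>

section \<open>Venn regions and free vertices\<close>

text \<open>
  The set \<open>label k E x\<close> names the Venn region of \<open>E 0, \<dots>, E (k - 1)\<close> that contains \<open>x\<close>, so
  \<open>card (label k E ` V)\<close> is the number of nonempty regions in \<open>V\<close>.
\<close>

definition label :: "nat \<Rightarrow> (nat \<Rightarrow> 'a set) \<Rightarrow> 'a \<Rightarrow> nat set" where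
  "label k E x = {i. i < k \<and> x \<in> E i}"

definition has_regions :: "nat \<Rightarrow> nat \<Rightarrow> 'a set \<Rightarrow> 'a set set \<Rightarrow> bool" where
  "has_regions k m V H \<longleftrightarrow> (\<exists>E. (\<forall>i<k. E i \<in> H) \<and> m \<le> card (label k E ` V))"

text \<open>
  Here \<open>Q\<close> is a structure that large families cannot avoid. The bound uses \<open>card V + 1\<close> so that it
  also makes sense on the empty vertex set.
\<close>

definition poly_bdd :: "('a set \<Rightarrow> 'a set set \<Rightarrow> bool) \<Rightarrow> nat \<Rightarrow> bool" where
  "poly_bdd Q d \<longleftrightarrow> (\<exists>C. \<forall>V H. finite V \<longrightarrow> H \<subseteq> Pow V \<longrightarrow> \<not> Q V H \<longrightarrow>
     card H \<le> C * (card V + 1) ^ d)"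

definition link :: "'a \<Rightarrow> 'a set set \<Rightarrow> 'a set set" where
  "link v H = {E \<in> H. v \<notin> E \<and> insert v E \<in> H}"

lemma label_in_Pow: "label k E ` V \<subseteq> Pow {..<k}"
  by (auto simp: label_def)

lemma finite_label_image [simp]: "finite (label k E ` V)"
  by (rule finite_subset[OF label_in_Pow]) simp

lemma card_label_le: "card (label k E ` V) \<le> 2 ^ k"
proof -
  have "card (label k E ` V) \<le> card (Pow {..<k})"
    by (rule card_mono[OF _ label_in_Pow]) simp
  then show ?thesis by (simp add: card_Pow)
qed

lemma label_image_eq_Pow: "2 ^ k \<le> card (label k E ` V) \<longleftrightarrow> label k E ` V = Pow {..<k}"
proof
  assume "2 ^ k \<le> card (label k E ` V)"
  then show "label k E ` V = Pow {..<k}"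
    by (intro card_subset_eq[OF _ label_in_Pow])
       (use card_label_le[of k E V] in \<open>auto simp: card_Pow\<close>)
qed (simp add: card_Pow)

lemma label_cong: "(\<And>i. i < k \<Longrightarrow> x \<in> E i \<longleftrightarrow> y \<in> F i) \<Longrightarrow> label k E x = label k F y"
  by (auto simp: label_def)

lemma finite_family: "finite V \<Longrightarrow> H \<subseteq> Pow V \<Longrightarrow> finite H"
  by (meson finite_Pow_iff finite_subset)

lemma has_regions_mono:
  "has_regions k m V H \<Longrightarrow> H \<subseteq> H' \<Longrightarrow> m' \<le> m \<Longrightarrow> has_regions k m' V H'"
  unfolding has_regions_def by (meson le_trans subsetD)

text \<open>
  Different members may have the same trace; any choice of members with the given traces will do.
\<close>

lemma has_regions_trace:
  assumes "W \<subseteq> V" "has_regions k m W ((\<lambda>E. E \<inter> W) ` H)"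
  shows "has_regions k m V H"
proof -
  obtain E where E: "\<forall>i<k. E i \<in> (\<lambda>E. E \<inter> W) ` H" "m \<le> card (label k E ` W)"
    using assms(2) by (auto simp: has_regions_def)
  then have "\<forall>i. \<exists>X. i < k \<longrightarrow> X \<in> H \<and> E i = X \<inter> W" by blast
  then obtain F where F: "\<And>i. i < k \<Longrightarrow> F i \<in> H \<and> E i = F i \<inter> W" by metis
  have "label k E ` W = label k F ` W"
    by (intro image_cong refl label_cong) (use F in auto)
  also have "\<dots> \<subseteq> label k F ` V" using assms(1) by blast
  finally have "card (label k E ` W) \<le> card (label k F ` V)" by (intro card_mono) simp_all
  then have "m \<le> card (label k F ` V)" using E(2) by simp
  then show ?thesis using F unfolding has_regions_def by (intro exI[of _ F]) simp
qed

text \<open>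
  After deletion of \<open>v\<close> two members become equal iff they are \<open>E\<close> and \<open>insert v E\<close> for some \<open>E\<close> in
  the link.
\<close>

lemma card_link:
  assumes "finite H"
  shows "card H = card ((\<lambda>E. E - {v}) ` H) + card (link v H)"
proof -
  define H0 where "H0 = {E \<in> H. v \<notin> E}"
  define H1 where "H1 = {E \<in> H. v \<in> E}"
  define H2 where "H2 = (\<lambda>E. E - {v}) ` H1"
  have fin: "finite H0" "finite H1" "finite H2" using assms by (auto simp: H0_def H1_def H2_def)
  have inj: "inj_on (\<lambda>E. E - {v}) H1" by (auto simp: H1_def inj_on_def)
  have "card H = card (H0 \<union> H1)" by (rule arg_cong[of _ _ card]) (auto simp: H0_def H1_def)
  also have "\<dots> = card H0 + card H1"
    using fin by (intro card_Un_disjoint) (auto simp: H0_def H1_def)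
  also have "card H1 = card H2" unfolding H2_def using inj by (simp add: card_image)
  also have "card H0 + card H2 = card (H0 \<union> H2) + card (H0 \<inter> H2)"
    using fin by (intro card_Un_Int)
  also have "H0 \<union> H2 = (\<lambda>E. E - {v}) ` H"
  proof -
    have "(\<lambda>E. E - {v}) ` H0 = id ` H0" by (intro image_cong) (auto simp: H0_def)
    moreover have "H = H0 \<union> H1" by (auto simp: H0_def H1_def)
    ultimately show ?thesis by (simp add: H2_def image_Un)
  qed
  also have "H0 \<inter> H2 = link v H"
  proof (intro equalityI subsetI)
    fix X assume "X \<in> H0 \<inter> H2"
    then show "X \<in> link v H" by (auto simp: H0_def H2_def H1_def link_def insert_absorb)
  next
    fix X assume X: "X \<in> link v H"
    then have "insert v X \<in> H1" "X = insert v X - {v}" by (auto simp: link_def H1_def)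
    then show "X \<in> H0 \<inter> H2" using X unfolding H2_def by (auto simp: H0_def link_def)
  qed
  finally show ?thesis .
qed

lemma link_subset_Pow: "H \<subseteq> Pow V \<Longrightarrow> link v H \<subseteq> Pow (V - {v})"
  by (auto simp: link_def)

text \<open>
  Each set of the link may be exchanged for itself with \<open>v\<close> added. This does not change the regions
  outside \<open>v\<close>, and \<open>v\<close> can be put into a region of choice.
\<close>

lemma has_regions_link:
  assumes fin: "finite V" and H: "H \<subseteq> Pow V" and v: "v \<in> V"
    and lk: "has_regions k m (V - {v}) (link v H)" and m: "m < 2 ^ k"
  shows "has_regions k (m + 1) V H"
proof -
  obtain E where E: "\<forall>i<k. E i \<in> link v H" "m \<le> card (label k E ` (V - {v}))"
    using lk by (auto simp: has_regions_def)
  define R where "R = label k E ` (V - {v})"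
  have "\<exists>L\<subseteq>{..<k}. m + 1 \<le> card (insert L R)"
  proof (cases "m + 1 \<le> card R")
    case True
    then have "m + 1 \<le> card (insert {} R)" by (meson card_insert_le le_trans)
    then show ?thesis by blast
  next
    case False
    then have "card R = m" using E(2) by (simp add: R_def)
    then have "R \<noteq> Pow {..<k}" using m by (auto simp: card_Pow)
    then obtain L where L: "L \<subseteq> {..<k}" "L \<notin> R" using label_in_Pow[of k E "V - {v}"] unfolding R_def by blast
    then have "card (insert L R) = m + 1" using \<open>card R = m\<close> by (simp add: R_def)
    then show ?thesis using L(1) by auto
  qed
  then obtain L where L: "L \<subseteq> {..<k}" "m + 1 \<le> card (insert L R)" by blast
  define F where "F i = (if i \<in> L then insert v (E i) else E i)" for i
  have "label k F ` (V - {v}) = R"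
    unfolding R_def by (intro image_cong refl label_cong) (auto simp: F_def)
  moreover have "label k F v = L"
    using E(1) L(1) by (auto simp: label_def F_def link_def split: if_splits)
  ultimately have "label k F ` V = insert L R"
    using v by (metis image_insert insert_Diff)
  then have "m + 1 \<le> card (label k F ` V)" using L(2) by simp
  moreover have "\<forall>i<k. F i \<in> H" using E(1) by (auto simp: F_def link_def)
  ultimately show ?thesis unfolding has_regions_def by (intro exI[of _ F] conjI)
qed

lemma trace_delete: "H \<subseteq> Pow V \<Longrightarrow> (\<lambda>E. E - {v}) ` H = (\<lambda>E. E \<inter> (V - {v})) ` H"
  by (intro image_cong) auto

text \<open>
  Delete all vertices one after the other. The number of sets drops from \<open>card H\<close> to at most one,
  and each step costs the size of a link in a trace of \<open>H\<close>, where \<open>m\<close> regions are excluded.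
\<close>

lemma poly_bdd_add_region:
  assumes "poly_bdd (has_regions k m :: 'a set \<Rightarrow> _) d" and m: "m < 2 ^ k"
  shows "poly_bdd (has_regions k (m + 1) :: 'a set \<Rightarrow> _) (d + 1)"
proof -
  obtain C where C: "\<And>V H :: 'a set set. finite V \<Longrightarrow> H \<subseteq> Pow V \<Longrightarrow> \<not> has_regions k m V H \<Longrightarrow>
      card H \<le> C * (card V + 1) ^ d"
    using assms(1) unfolding poly_bdd_def by blast
  have main: "card H \<le> 1 + C * card V * (card V + 1) ^ d"
    if "finite V" "H \<subseteq> Pow V" "\<not> has_regions k (m + 1) V H" for V and H :: "'a set set"
    using that
  proof (induction V arbitrary: H rule: finite_induct)
    case empty
    then have "H \<subseteq> {{}}" by simp
    then have "card H \<le> card {{} :: 'a set}" by (intro card_mono) auto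
    then show ?case by simp
  next
    case (insert v V)
    define n where "n = card V"
    have V: "insert v V - {v} = V" using insert.hyps by simp
    have del: "(\<lambda>E. E - {v}) ` H = (\<lambda>E. E \<inter> V) ` H"
      using trace_delete[OF insert.prems(1), of v] V by simp
    have "\<not> has_regions k (m + 1) V ((\<lambda>E. E - {v}) ` H)"
      using has_regions_trace[of V "insert v V" k "m + 1" H] insert.prems(2) del by auto
    then have 1: "card ((\<lambda>E. E - {v}) ` H) \<le> 1 + C * n * (n + 1) ^ d"
      unfolding n_def using insert.prems by (intro insert.IH) auto
    have "\<not> has_regions k m V (link v H)"
      using has_regions_link[of "insert v V" H v k m] insert V m by auto
    then have 2: "card (link v H) \<le> C * (n + 1) ^ d"
      unfolding n_def using link_subset_Pow[OF insert.prems(1), of v] V insert.hyps by (intro C) auto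
    have "finite H" using finite_family[OF _ insert.prems(1)] insert.hyps by simp
    then have "card H \<le> (1 + C * n * (n + 1) ^ d) + C * (n + 1) ^ d"
      using card_link[of H v] 1 2 by linarith
    also have "\<dots> = 1 + C * (n + 1) * (n + 1) ^ d" by (simp add: algebra_simps)
    also have "\<dots> \<le> 1 + C * (n + 1) * (n + 2) ^ d"
      by (intro add_mono mult_mono power_mono) auto
    finally show ?case using insert.hyps by (simp add: n_def)
  qed
  have "card H \<le> (C + 1) * (card V + 1) ^ (d + 1)"
    if "finite V" "H \<subseteq> Pow V" "\<not> has_regions k (m + 1) V H" for V and H :: "'a set set"
  proof -
    define P where "P = (card V + 1) ^ (d + 1)"
    have "card V * (card V + 1) ^ d \<le> P" by (simp add: P_def mult_le_mono)
    then have "C * card V * (card V + 1) ^ d \<le> C * P" by (simp add: mult.assoc)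
    moreover have "1 \<le> P" unfolding P_def by (rule one_le_power) simp
    ultimately have "1 + C * card V * (card V + 1) ^ d \<le> (C + 1) * P"
      unfolding distrib_right by linarith
    then show ?thesis using main[OF that] unfolding P_def by linarith
  qed
  then show ?thesis unfolding poly_bdd_def by blast
qed

lemma poly_bdd_add_regions:
  assumes "poly_bdd (has_regions k m :: 'a set \<Rightarrow> _) d" and "m + j \<le> 2 ^ k"
  shows "poly_bdd (has_regions k (m + j) :: 'a set \<Rightarrow> _) (d + j)"
  using assms(2)
proof (induction j)
  case 0
  then show ?case using assms(1) by simp
next
  case (Suc j)
  then show ?case using poly_bdd_add_region[of k "m + j" "d + j"] by simp
qed

section \<open>Members that cut at most one region\<close>

text \<open>
  A further set \<open>X\<close> adds one region for each old region that it cuts.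
\<close>

lemma card_label_upd:
  assumes "finite V"
  shows "card (label (Suc k) (E(k := X)) ` V) =
    card (label k E ` V) + card (label k E ` (V \<inter> X) \<inter> label k E ` (V - X))"
proof -
  define T1 where "T1 = label k E ` (V \<inter> X)"
  define T0 where "T0 = label k E ` (V - X)"
  have fin: "finite T0" "finite T1" by (simp_all add: T0_def T1_def)
  have k: "k \<notin> L" if "L \<in> T0 \<union> T1" for L using that by (auto simp: T0_def T1_def label_def)
  have *: "label (Suc k) (E(k := X)) x = (if x \<in> X then insert k (label k E x) else label k E x)" for x
    by (auto simp: label_def less_Suc_eq)
  have "label (Suc k) (E(k := X)) ` V = T0 \<union> insert k ` T1"
    unfolding T0_def T1_def by (force simp: *)
  also have "card \<dots> = card T0 + card (insert k ` T1)"
    using fin k by (intro card_Un_disjoint) auto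
  also have "card (insert k ` T1) = card T1"
    using k by (intro card_image) (auto simp: inj_on_def insert_ident)
  also have "card T0 + card T1 = card (T0 \<union> T1) + card (T0 \<inter> T1)"
    using fin by (rule card_Un_Int)
  also have "T0 \<union> T1 = label k E ` V" unfolding T0_def T1_def by auto
  finally show ?thesis by (simp only: T0_def T1_def Int_commute)
qed

lemma sum_power_le_power_sum:
  fixes y :: "'b \<Rightarrow> nat"
  assumes "finite A" "d > 0"
  shows "(\<Sum>a\<in>A. y a ^ d) \<le> (\<Sum>a\<in>A. y a) ^ d"
proof -
  obtain e where d: "d = Suc e" using assms(2) gr0_implies_Suc by blast
  have "(\<Sum>a\<in>A. y a ^ d) \<le> (\<Sum>a\<in>A. y a * (\<Sum>a\<in>A. y a) ^ e)"
    unfolding d power_Suc using assms(1)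
    by (intro sum_mono mult_le_mono2 power_mono member_le_sum) auto
  also have "\<dots> = (\<Sum>a\<in>A. y a) ^ d" by (simp add: d sum_distrib_right)
  finally show ?thesis .
qed

text \<open>
  The recursion over the regions of \<open>k\<close> members that have all \<open>2 ^ k\<close> regions. The predicate \<open>Q\<close>
  covers the case of \<open>2 ^ k + 2\<close> regions, and it is inherited from quotients: if each point of \<open>V\<close>
  lies in the same members of a subfamily \<open>H'\<close> as some point of \<open>W\<close>, then \<open>H'\<close> may be regarded as
  a family on \<open>W\<close>.

  Let \<open>N = 2 ^ k\<close>, and write \<open>A L\<close> for the region of label \<open>L\<close>. The sets of \<open>H\<close> which are constant on
  all regions but \<open>A L\<close> live on the points of \<open>A L\<close> and one representative of each other region, that
  is on \<open>card (A L) + N - 1\<close> points. With the bound \<open>C * (n - N) ^ d\<close> such a family contributes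
  \<open>C * (card (A L) - 1) ^ d\<close>, and the numbers \<open>card (A L) - 1\<close> add up to \<open>n - N\<close>. So the bound is
  reproduced. The constant \<open>D\<close> pays for the at most \<open>2 ^ N\<close> sets which are constant on all regions: it
  occurs once in the claim for \<open>H\<close>, and at least twice in the induction hypotheses, as there are two
  regions with more than one point. If there are no such two regions, the premise \<open>small\<close> takes over.
\<close>

lemma atom_recursion:
  fixes Q :: "'a set \<Rightarrow> 'a set set \<Rightarrow> bool"
  assumes Qreg: "\<And>V H. finite V \<Longrightarrow> H \<subseteq> Pow V \<Longrightarrow> has_regions (Suc k) (2 ^ k + 2) V H \<Longrightarrow> Q V H"
    and Qquot: "\<And>V W H H'. finite V \<Longrightarrow> W \<subseteq> V \<Longrightarrow> H \<subseteq> Pow V \<Longrightarrow> H' \<subseteq> H \<Longrightarrow>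
        (\<And>x. x \<in> V \<Longrightarrow> \<exists>w\<in>W. \<forall>E\<in>H'. x \<in> E \<longleftrightarrow> w \<in> E) \<Longrightarrow> Q W ((\<lambda>E. E \<inter> W) ` H') \<Longrightarrow> Q V H"
    and small: "\<And>V H. finite V \<Longrightarrow> H \<subseteq> Pow V \<Longrightarrow> \<not> Q V H \<Longrightarrow>
        (\<And>E. (\<And>i. i < k \<Longrightarrow> E i \<in> H) \<Longrightarrow> label k E ` V = Pow {..<k} \<Longrightarrow>
          \<exists>L0. \<forall>L. L \<subseteq> {..<k} \<longrightarrow> L \<noteq> L0 \<longrightarrow> card {x \<in> V. label k E x = L} \<le> 1) \<Longrightarrow>
        card H \<le> K * (card V + 1) ^ d"
    and d: "d > 0"
  shows "poly_bdd Q d"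
proof -
  define N :: nat where "N = 2 ^ k"
  define D :: nat where "D = 2 ^ N"
  define C where "C = K * (N + 2) ^ d + D"
  have main: "card H + D \<le> C * (card V - N) ^ d"
    if "finite V" "H \<subseteq> Pow V" "\<not> Q V H" "N < card V" for V and H :: "'a set set"
    using that
  proof (induction "card V" arbitrary: V H rule: less_induct)
    case less
    note fin = \<open>finite V\<close> and H = \<open>H \<subseteq> Pow V\<close> and nQ = \<open>\<not> Q V H\<close> and NV = \<open>N < card V\<close>
    have finH: "finite H" using fin H by (rule finite_family)
    show ?case
    proof (cases "\<forall>E. (\<forall>i<k. E i \<in> H) \<longrightarrow> label k E ` V = Pow {..<k} \<longrightarrow>
          (\<exists>L0. \<forall>L. L \<subseteq> {..<k} \<longrightarrow> L \<noteq> L0 \<longrightarrow> card {x \<in> V. label k E x = L} \<le> 1)")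
      case True
      then have "card H \<le> K * (card V + 1) ^ d"
        by (intro small[OF fin H nQ]) blast
      also have "\<dots> \<le> K * ((N + 2) * (card V - N)) ^ d"
      proof (intro mult_le_mono2 power_mono)
        obtain y where "card V = N + Suc y" using NV less_imp_Suc_add by fastforce
        then show "card V + 1 \<le> (N + 2) * (card V - N)" by simp
      qed simp
      finally have "card H \<le> K * (N + 2) ^ d * (card V - N) ^ d"
        by (simp only: power_mult_distrib mult.assoc)
      moreover have "D \<le> D * (card V - N) ^ d" using NV by simp
      ultimately have "card H + D \<le> K * (N + 2) ^ d * (card V - N) ^ d + D * (card V - N) ^ d"
        by (rule add_mono)
      then show ?thesis by (simp only: C_def distrib_right)
    next
      case False
      then obtain E where E0: "\<forall>i<k. E i \<in> H" and VD: "label k E ` V = Pow {..<k}"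
        and big0: "\<not> (\<exists>L0. \<forall>L. L \<subseteq> {..<k} \<longrightarrow> L \<noteq> L0 \<longrightarrow> card {x \<in> V. label k E x = L} \<le> 1)"
        unfolding not_all[where 'a = "nat \<Rightarrow> 'a set"] not_imp by (elim exE conjE) (rule that)
      have E: "E i \<in> H" if "i < k" for i using E0 that by simp
      have big: "\<exists>L\<subseteq>{..<k}. L \<noteq> L0 \<and> 2 \<le> card {x \<in> V. label k E x = L}" for L0
      proof -
        obtain L where "L \<subseteq> {..<k}" "L \<noteq> L0" "\<not> card {x \<in> V. label k E x = L} \<le> 1"
          using big0 by blast
        then show ?thesis by (intro exI[of _ L]) auto
      qed
      define A where "A L = {x \<in> V. label k E x = L}" for L
      define P where "P = Pow {..<k}"
      have finP: "finite P" and cardP: "card P = N" by (simp_all add: P_def N_def card_Pow)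
      have finA: "finite (A L)" for L using fin by (simp add: A_def)
      have "\<exists>x. x \<in> A L" if "L \<in> P" for L
      proof -
        have "L \<in> label k E ` V" using that VD by (simp add: P_def)
        then show ?thesis by (auto simp: A_def)
      qed
      then obtain r where r: "\<And>L. L \<in> P \<Longrightarrow> r L \<in> A L" by metis
      have labelP: "label k E x \<in> P" for x by (auto simp: P_def label_def)
      have rlabel: "label k E (r L) = L" "r L \<in> V" if "L \<in> P" for L using r[OF that] by (auto simp: A_def)
      define const where "const X L \<longleftrightarrow> (\<forall>x\<in>A L. x \<in> X \<longleftrightarrow> r L \<in> X)" for X L
      \<comment> \<open>a member that cuts two atoms would give too many regions\<close>
      have one: "L = L'" if X: "X \<in> H" and L: "L \<in> P" "\<not> const X L" and L': "L' \<in> P" "\<not> const X L'" for X L L'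
      proof (rule ccontr)
        assume ne: "L \<noteq> L'"
        define T where "T = label k E ` (V \<inter> X) \<inter> label k E ` (V - X)"
        have cut: "M \<in> T" if M: "M \<in> P" "\<not> const X M" for M
        proof -
          obtain x where x: "x \<in> A M" "(x \<in> X) \<noteq> (r M \<in> X)" using M by (auto simp: const_def)
          then show ?thesis using r[OF M(1)] by (cases "x \<in> X") (auto simp: T_def A_def image_iff)
        qed
        have "finite T" by (simp add: T_def)
        then have "card {L, L'} \<le> card T" using cut[OF L] cut[OF L'] by (intro card_mono) auto
        then have "2 \<le> card T" using ne by simp
        then have "2 ^ k + 2 \<le> card (label (Suc k) (E(k := X)) ` V)"
          unfolding card_label_upd[OF fin] VD T_def by (simp add: card_Pow)
        moreover have "(E(k := X)) i \<in> H" if "i < Suc k" for i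
          using that E X by (auto simp: less_Suc_eq)
        ultimately have "has_regions (Suc k) (2 ^ k + 2) V H"
          unfolding has_regions_def by (intro exI[of _ "E(k := X)"]) blast
        then show False using Qreg[OF fin H] nQ by blast
      qed
      define H0 where "H0 = {X \<in> H. \<forall>L\<in>P. const X L}"
      define HL where "HL L = {X \<in> H. \<forall>L'\<in>P - {L}. const X L'}" for L
      define J where "J = {L \<in> P. 2 \<le> card (A L)}"
      have J: "finite J" "J \<subseteq> P" using finP by (auto simp: J_def)
      have cover: "H \<subseteq> H0 \<union> (\<Union>L\<in>J. HL L)"
      proof
        fix X assume X: "X \<in> H"
        show "X \<in> H0 \<union> (\<Union>L\<in>J. HL L)"
        proof (cases "X \<in> H0")
          case False
          then obtain L where L: "L \<in> P" "\<not> const X L" using X by (auto simp: H0_def)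
          then obtain x where x: "x \<in> A L" "(x \<in> X) \<noteq> (r L \<in> X)" by (auto simp: const_def)
          then have "card {x, r L} \<le> card (A L)" using r[OF L(1)] finA by (intro card_mono) auto
          moreover have "x \<noteq> r L" using x by auto
          ultimately have "L \<in> J" using L by (simp add: J_def)
          moreover have "X \<in> HL L" using X one[OF X L] by (auto simp: HL_def)
          ultimately show ?thesis by blast
        qed simp
      qed
      have H0: "card H0 \<le> D"
      proof -
        have "inj_on (\<lambda>X. {L \<in> P. r L \<in> X}) H0"
        proof (rule inj_onI)
          fix X Y assume XY: "X \<in> H0" "Y \<in> H0" and eq: "{L \<in> P. r L \<in> X} = {L \<in> P. r L \<in> Y}"
          have "x \<in> X \<longleftrightarrow> x \<in> Y" if "x \<in> V" for x
          proof -
            have "x \<in> A (label k E x)" using that by (simp add: A_def)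
            then have "x \<in> X \<longleftrightarrow> r (label k E x) \<in> X" "x \<in> Y \<longleftrightarrow> r (label k E x) \<in> Y"
              using XY labelP[of x] unfolding H0_def const_def by blast+
            then show ?thesis using eq labelP[of x] by blast
          qed
          then show "X = Y" using XY H by (auto simp: H0_def)
        qed
        then have "card H0 \<le> card (Pow P)" using finP by (intro card_inj_on_le) auto
        then show ?thesis using finP by (simp add: card_Pow cardP D_def)
      qed
      have HL: "card (HL L) + D \<le> C * (card (A L) - 1) ^ d" if L: "L \<in> J" for L
      proof -
        have LP: "L \<in> P" and two: "2 \<le> card (A L)" using L by (auto simp: J_def)
        define W where "W = A L \<union> r ` (P - {L})"
        have W: "W \<subseteq> V" using rlabel by (auto simp: W_def A_def)
        have "inj_on r P" by (metis inj_onI rlabel(1))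
        then have "card (r ` (P - {L})) = N - 1"
          using LP finP cardP by (simp add: card_image inj_on_diff)
        moreover have "A L \<inter> r ` (P - {L}) = {}" using rlabel by (auto simp: A_def)
        ultimately have cW: "card W = card (A L) + (N - 1)"
          unfolding W_def using finA finP by (subst card_Un_disjoint) auto
        have N: "N > 0" by (simp add: N_def)
        obtain L' where L': "L' \<in> P" "L' \<noteq> L" "2 \<le> card (A L')"
          using big[of L] by (auto simp: A_def P_def)
        have "\<exists>y\<in>A L'. y \<noteq> r L'"
        proof (rule ccontr)
          assume "\<not> ?thesis"
          then have "A L' \<subseteq> {r L'}" by auto
          then have "card (A L') \<le> card {r L'}" by (intro card_mono) auto
          then show False using L' by simp
        qed
        then obtain y where y: "y \<in> A L'" "y \<noteq> r L'" by blast
        then have "y \<notin> W" using L' rlabel by (auto simp: W_def A_def)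
        then have "W \<subset> V" using W y by (auto simp: A_def)
        then have less_card: "card W < card V" using fin by (rule psubset_card_mono[rotated])
        have twin: "\<exists>w\<in>W. \<forall>X\<in>HL L. x \<in> X \<longleftrightarrow> w \<in> X" if x: "x \<in> V" for x
        proof (cases "label k E x = L")
          case True
          then have "x \<in> W" using x by (simp add: W_def A_def)
          then show ?thesis by blast
        next
          case False
          then have "r (label k E x) \<in> W" using labelP[of x] by (auto simp: W_def)
          moreover have "\<forall>X\<in>HL L. x \<in> X \<longleftrightarrow> r (label k E x) \<in> X"
            using False labelP[of x] x by (auto simp: HL_def const_def A_def)
          ultimately show ?thesis by blast
        qed
        have sub: "HL L \<subseteq> H" by (auto simp: HL_def)
        have "\<not> Q W ((\<lambda>X. X \<inter> W) ` HL L)" using Qquot[OF fin W H sub twin] nQ by blast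
        moreover have "finite W" using W fin finite_subset by blast
        moreover have "N < card W" using cW two N by linarith
        ultimately have "card ((\<lambda>X. X \<inter> W) ` HL L) + D \<le> C * (card W - N) ^ d"
          using less_card by (intro less.hyps) auto
        moreover have "inj_on (\<lambda>X. X \<inter> W) (HL L)"
        proof (rule inj_onI)
          fix X Y assume XY: "X \<in> HL L" "Y \<in> HL L" and eq: "X \<inter> W = Y \<inter> W"
          have "x \<in> X \<longleftrightarrow> x \<in> Y" if "x \<in> V" for x using twin[OF that] XY eq by blast
          then show "X = Y" using XY H sub by blast
        qed
        moreover have "card W - N = card (A L) - 1" using cW two N by linarith
        ultimately show ?thesis by (simp add: card_image)
      qed
      have J2: "2 \<le> card J"
      proof -
        obtain L1 where L1: "L1 \<in> J" using big[of "{k}"] by (auto simp: J_def P_def A_def)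
        obtain L2 where L2: "L2 \<in> J" "L2 \<noteq> L1" using big[of L1] by (auto simp: J_def P_def A_def)
        have "card {L1, L2} \<le> card J" using L1 L2 J by (intro card_mono) auto
        then show ?thesis using L2 by simp
      qed
      have "card H \<le> card (H0 \<union> (\<Union>L\<in>J. HL L))"
        using cover J finH by (intro card_mono) (auto simp: H0_def HL_def)
      also have "\<dots> \<le> card H0 + card (\<Union>L\<in>J. HL L)" by (rule card_Un_le)
      also have "\<dots> \<le> D + (\<Sum>L\<in>J. card (HL L))"
        using H0 card_UN_le[OF J(1), of HL] by (rule add_mono)
      finally have "card H + D \<le> 2 * D + (\<Sum>L\<in>J. card (HL L))" by simp
      also have "\<dots> \<le> card J * D + (\<Sum>L\<in>J. card (HL L))" using J2 by simp
      also have "\<dots> = (\<Sum>L\<in>J. card (HL L) + D)" by (simp add: sum.distrib)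
      also have "\<dots> \<le> (\<Sum>L\<in>J. C * (card (A L) - 1) ^ d)" by (intro sum_mono HL)
      also have "\<dots> \<le> (\<Sum>L\<in>P. C * (card (A L) - 1) ^ d)" using J finP by (intro sum_mono2) auto
      also have "\<dots> = C * (\<Sum>L\<in>P. (card (A L) - 1) ^ d)" by (simp add: sum_distrib_left)
      also have "\<dots> \<le> C * (\<Sum>L\<in>P. card (A L) - 1) ^ d"
        by (intro mult_le_mono2 sum_power_le_power_sum finP d)
      also have "(\<Sum>L\<in>P. card (A L) - 1) = card V - N"
      proof -
        have pos: "1 \<le> card (A L)" if "L \<in> P" for L
          using r[OF that] finA[of L] by (metis One_nat_def Suc_leI card_gt_0_iff empty_iff)
        have "V = (\<Union>L\<in>P. A L)" using labelP by (auto simp: A_def)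
        also have "card \<dots> = (\<Sum>L\<in>P. card (A L))"
          using finP finA by (intro card_UN_disjoint) (auto simp: A_def)
        also have "\<dots> = (\<Sum>L\<in>P. (card (A L) - 1) + 1)"
          by (rule sum.cong) (use pos in \<open>auto simp: Suc_le_eq\<close>)
        also have "\<dots> = (\<Sum>L\<in>P. card (A L) - 1) + N" by (simp only: sum.distrib sum_constant cardP mult_1_right of_nat_id)
        finally show ?thesis by linarith
      qed
      finally show ?thesis .
    qed
  qed
  have "card H \<le> (C + D) * (card V + 1) ^ d"
    if "finite V" "H \<subseteq> Pow V" "\<not> Q V H" for V and H :: "'a set set"
  proof (cases "N < card V")
    case True
    have "card H \<le> C * (card V - N) ^ d" using main[OF that True] by linarith
    also have "\<dots> \<le> (C + D) * (card V + 1) ^ d" by (intro mult_le_mono power_mono) auto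
    finally show ?thesis .
  next
    case False
    have "card H \<le> card (Pow V)" using that by (intro card_mono) auto
    also have "\<dots> \<le> D" using that False by (simp add: card_Pow D_def)
    also have "\<dots> \<le> (C + D) * (card V + 1) ^ d"
    proof -
      have "1 \<le> (card V + 1) ^ d" by (rule one_le_power) simp
      then have "(C + D) * 1 \<le> (C + D) * (card V + 1) ^ d" by (rule mult_le_mono2)
      then show ?thesis by (rule order_trans[rotated]) simp
    qed
    finally show ?thesis .
  qed
  then show ?thesis unfolding poly_bdd_def by blast
qed

lemma card_Pow_member:
  assumes "k > 0"
  shows "card {L. L \<subseteq> {..<k} \<and> (0::nat) \<in> L} = 2 ^ (k - 1)"
    and "card {L. L \<subseteq> {..<k} \<and> (0::nat) \<notin> L} = 2 ^ (k - 1)"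
proof -
  have *: "{L. L \<subseteq> {..<k} \<and> (0::nat) \<notin> L} = Pow {1..<k}"
    by (auto simp: subset_iff Suc_le_eq) (metis neq0_conv)
  then show 2: "card {L. L \<subseteq> {..<k} \<and> (0::nat) \<notin> L} = 2 ^ (k - 1)" by (simp add: card_Pow)
  have "{L. L \<subseteq> {..<k} \<and> (0::nat) \<in> L} = insert 0 ` Pow {1..<k}"
  proof (intro equalityI subsetI)
    fix L assume "L \<in> {L. L \<subseteq> {..<k} \<and> (0::nat) \<in> L}"
    then have "L = insert 0 (L - {0})" "L - {0} \<in> Pow {1..<k}" by (auto simp: subset_iff Suc_le_eq)
    then show "L \<in> insert 0 ` Pow {1..<k}" by blast
  qed (use assms in auto)
  moreover have "inj_on (insert 0) (Pow {1..<k})"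
    by (rule inj_on_inverseI[of _ "\<lambda>L. L - {0}"]) auto
  ultimately show "card {L. L \<subseteq> {..<k} \<and> (0::nat) \<in> L} = 2 ^ (k - 1)"
    by (simp add: card_image card_Pow)
qed

text \<open>
  The set \<open>E 0\<close> is the union of the \<open>2 ^ (k - 1)\<close> regions whose label contains \<open>0\<close>, and its complement
  is the union of the other \<open>2 ^ (k - 1)\<close> regions. The exceptional label \<open>L0\<close> spoils only one of the
  two counts.
\<close>

lemma small_atoms_card:
  assumes fin: "finite V" and k: "k > 0" and VD: "label k E ` V = Pow {..<k}" and E0: "E 0 \<subseteq> V"
    and small: "\<And>L. L \<subseteq> {..<k} \<Longrightarrow> L \<noteq> L0 \<Longrightarrow> card {x \<in> V. label k E x = L} \<le> 1"
  shows "card (E 0) = 2 ^ (k - 1) \<or> card (V - E 0) = 2 ^ (k - 1)"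
proof -
  have inj: "x = y" if "x \<in> V" "y \<in> V" "label k E x = label k E y" "label k E x \<noteq> L0" for x y
  proof -
    have "card {x, y} \<le> card {z \<in> V. label k E z = label k E x}"
      using that fin by (intro card_mono) auto
    also have "\<dots> \<le> 1" using that(4) by (intro small) (auto simp: label_def)
    finally show ?thesis by (cases "x = y") auto
  qed
  have zero: "0 \<in> label k E x \<longleftrightarrow> x \<in> E 0" for x using k by (auto simp: label_def)
  have surj: "\<exists>x\<in>V. label k E x = L" if "L \<subseteq> {..<k}" for L
  proof -
    have "L \<in> label k E ` V" using that VD by simp
    then show ?thesis by auto
  qed
  show ?thesis
  proof (cases "0 \<in> L0")
    case True
    have "bij_betw (label k E) (V - E 0) {L. L \<subseteq> {..<k} \<and> 0 \<notin> L}"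
    proof (rule bij_betw_imageI)
      show "inj_on (label k E) (V - E 0)" using inj True zero by (intro inj_onI) blast
      show "label k E ` (V - E 0) = {L. L \<subseteq> {..<k} \<and> 0 \<notin> L}"
      proof (intro equalityI subsetI)
        fix L assume "L \<in> {L. L \<subseteq> {..<k} \<and> 0 \<notin> L}"
        then show "L \<in> label k E ` (V - E 0)" using surj[of L] zero by blast
      qed (use zero in \<open>auto simp: label_def\<close>)
    qed
    then show ?thesis using card_Pow_member(2)[OF k] bij_betw_same_card by force
  next
    case False
    have "bij_betw (label k E) (E 0) {L. L \<subseteq> {..<k} \<and> 0 \<in> L}"
    proof (rule bij_betw_imageI)
      show "inj_on (label k E) (E 0)" using inj False zero E0 by (intro inj_onI) blast
      show "label k E ` E 0 = {L. L \<subseteq> {..<k} \<and> 0 \<in> L}"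
      proof (intro equalityI subsetI)
        fix L assume "L \<in> {L. L \<subseteq> {..<k} \<and> 0 \<in> L}"
        then show "L \<in> label k E ` E 0" using surj[of L] zero by blast
      qed (use zero in \<open>auto simp: label_def\<close>)
    qed
    then show ?thesis using card_Pow_member(1)[OF k] bij_betw_same_card by force
  qed
qed

text \<open>
  The remaining case of the recursion. If all but one of the regions are single points whenever \<open>k\<close>
  members of \<open>H\<close> have \<open>2 ^ k\<close> regions, then the members of \<open>H\<close> that have neither \<open>2 ^ (k - 1)\<close>
  elements nor a complement of that size avoid \<open>2 ^ k\<close> regions. The others form two uniform families,
  one of them after complementation.
\<close>

lemma reduction_to_uniform:
  fixes Q :: "'a set \<Rightarrow> 'a set set \<Rightarrow> bool"
  assumes Qreg: "\<And>V H. finite V \<Longrightarrow> H \<subseteq> Pow V \<Longrightarrow> has_regions (Suc k) (2 ^ k + 2) V H \<Longrightarrow> Q V H"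
    and Qquot: "\<And>V W H H'. finite V \<Longrightarrow> W \<subseteq> V \<Longrightarrow> H \<subseteq> Pow V \<Longrightarrow> H' \<subseteq> H \<Longrightarrow>
        (\<And>x. x \<in> V \<Longrightarrow> \<exists>w\<in>W. \<forall>E\<in>H'. x \<in> E \<longleftrightarrow> w \<in> E) \<Longrightarrow> Q W ((\<lambda>E. E \<inter> W) ` H') \<Longrightarrow> Q V H"
    and Qcompl: "\<And>V H. finite V \<Longrightarrow> H \<subseteq> Pow V \<Longrightarrow> Q V ((\<lambda>X. V - X) ` H) \<Longrightarrow> Q V H"
    and unif: "\<And>V H. finite V \<Longrightarrow> H \<subseteq> Pow V \<Longrightarrow> (\<And>X. X \<in> H \<Longrightarrow> card X = 2 ^ (k - 1)) \<Longrightarrow>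
        \<not> Q V H \<Longrightarrow> card H \<le> K * (card V + 1) ^ d"
    and k: "k > 0" and d: "d > 0"
    and VD: "poly_bdd (has_regions k (2 ^ k) :: 'a set \<Rightarrow> _) d"
  shows "poly_bdd Q d"
proof -
  obtain C where C: "\<And>V H :: 'a set set. finite V \<Longrightarrow> H \<subseteq> Pow V \<Longrightarrow> \<not> has_regions k (2 ^ k) V H \<Longrightarrow>
      card H \<le> C * (card V + 1) ^ d"
    using VD unfolding poly_bdd_def by blast
  have Qmono: "Q V H" if "finite V" "H \<subseteq> Pow V" "H' \<subseteq> H" "Q V H'" for V H H'
  proof -
    have "(\<lambda>E. E \<inter> V) ` H' = id ` H'" using that by (intro image_cong) auto
    then have "Q V ((\<lambda>E. E \<inter> V) ` H')" using that(4) by simp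
    then show ?thesis using that by (intro Qquot[of V V H H']) auto
  qed
  show ?thesis
  proof (rule atom_recursion[where k = k and d = d and Q = Q and K = "C + 2 * K", OF Qreg Qquot _ d])
    fix V and H :: "'a set set"
    assume fin: "finite V" and H: "H \<subseteq> Pow V" and nQ: "\<not> Q V H"
      and small: "\<And>E. (\<And>i. i < k \<Longrightarrow> E i \<in> H) \<Longrightarrow> label k E ` V = Pow {..<k} \<Longrightarrow>
          \<exists>L0. \<forall>L. L \<subseteq> {..<k} \<longrightarrow> L \<noteq> L0 \<longrightarrow> card {x \<in> V. label k E x = L} \<le> 1"
    define s :: nat where "s = 2 ^ (k - 1)"
    define p where "p = (card V + 1) ^ d"
    define H0 where "H0 = {X \<in> H. card X \<noteq> s \<and> card (V - X) \<noteq> s}"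
    define H1 where "H1 = {X \<in> H. card X = s}"
    define H2 where "H2 = {X \<in> H. card (V - X) = s}"
    have sub: "H0 \<subseteq> H" "H1 \<subseteq> H" "H2 \<subseteq> H" by (auto simp: H0_def H1_def H2_def)
    have "\<not> has_regions k (2 ^ k) V H0"
    proof
      assume "has_regions k (2 ^ k) V H0"
      then obtain E where E: "\<forall>i<k. E i \<in> H0" and VD: "label k E ` V = Pow {..<k}"
        unfolding has_regions_def label_image_eq_Pow by blast
      have "E i \<in> H" if "i < k" for i using E sub that by blast
      then obtain L0 where "\<forall>L. L \<subseteq> {..<k} \<longrightarrow> L \<noteq> L0 \<longrightarrow> card {x \<in> V. label k E x = L} \<le> 1"
        using small[OF _ VD] by blast
      moreover have "E 0 \<in> H0" using E k by simp
      moreover have "E 0 \<subseteq> V" using \<open>E 0 \<in> H0\<close> H sub by blast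
      ultimately show False
        using small_atoms_card[OF fin k VD, of L0] by (auto simp: H0_def s_def)
    qed
    then have 0: "card H0 \<le> C * p" unfolding p_def using sub H by (intro C fin) auto
    have "\<not> Q V H1" using Qmono[OF fin H sub(2)] nQ by blast
    then have 1: "card H1 \<le> K * p"
      unfolding p_def using sub H by (intro unif fin) (auto simp: H1_def s_def)
    have "\<not> Q V ((\<lambda>X. V - X) ` H2)"
      using Qmono[OF fin H sub(3)] Qcompl[OF fin, of H2] nQ sub H by blast
    then have "card ((\<lambda>X. V - X) ` H2) \<le> K * p"
      unfolding p_def by (intro unif fin) (auto simp: H2_def s_def)
    moreover have "inj_on (\<lambda>X. V - X) H2" using sub(3) H by (intro inj_onI) blast
    ultimately have 2: "card H2 \<le> K * p" by (simp add: card_image)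
    have finH: "finite H" using fin H by (rule finite_family)
    have "H = H0 \<union> (H1 \<union> H2)" by (auto simp: H0_def H1_def H2_def)
    then have "card H \<le> card H0 + (card H1 + card H2)"
      by (metis card_Un_le add_left_mono le_trans)
    also have "\<dots> \<le> C * p + (K * p + K * p)" using 0 1 2 by (intro add_mono)
    also have "\<dots> = (C + 2 * K) * p" by (simp add: algebra_simps)
    finally show "card H \<le> (C + 2 * K) * (card V + 1) ^ d" by (simp add: p_def)
  qed
qed

lemma has_regions_compl:
  assumes "H \<subseteq> Pow V" "has_regions k m V ((\<lambda>X. V - X) ` H)"
  shows "has_regions k m V H"
proof -
  obtain E where E: "\<forall>i<k. E i \<in> (\<lambda>X. V - X) ` H" "m \<le> card (label k E ` V)"
    using assms(2) by (auto simp: has_regions_def)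
  define F where "F i = V - E i" for i
  have F: "F i \<in> H" if "i < k" for i
  proof -
    have "E i \<in> (\<lambda>X. V - X) ` H" using E(1) that by simp
    then obtain X where "X \<in> H" "E i = V - X" by auto
    moreover have "V - (V - X) = X" using \<open>X \<in> H\<close> assms(1) by auto
    ultimately show ?thesis by (simp add: F_def)
  qed
  have "(\<lambda>L. {..<k} - L) ` label k F ` V = label k E ` V"
    unfolding image_image by (intro image_cong refl) (auto simp: label_def F_def)
  then have "m \<le> card (label k F ` V)" using E(2) card_image_le[of "label k F ` V" "\<lambda>L. {..<k} - L"] by simp
  then show ?thesis using F unfolding has_regions_def by (intro exI[of _ F]) simp
qed

lemma has_regions_quotient:
  assumes "W \<subseteq> V" "H' \<subseteq> H" "has_regions k m W ((\<lambda>E. E \<inter> W) ` H')"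
  shows "has_regions k m V H"
  using has_regions_mono[OF has_regions_trace[OF assms(1,3)] assms(2)] by simp


section \<open>Uniform families\<close>

lemma card_subsets_le:
  assumes "finite V" "r \<le> d"
  shows "card {D. D \<subseteq> V \<and> card D = r} \<le> (card V + 1) ^ d"
proof -
  have "card {D. D \<subseteq> V \<and> card D = r} = card V choose r" using assms(1) by (rule n_subsets)
  also have "\<dots> \<le> (card V + 1) ^ r"
  proof (cases "r \<le> card V")
    case True
    then have "card V choose r \<le> card V ^ r" by (rule binomial_le_pow)
    also have "\<dots> \<le> (card V + 1) ^ r" by (rule power_mono) auto
    finally show ?thesis .
  qed (simp add: binomial_eq_0)
  also have "\<dots> \<le> (card V + 1) ^ d" using assms(2) by (intro power_increasing) auto
  finally show ?thesis .
qed

definition shadow :: "'a set set \<Rightarrow> 'a set set" where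
  "shadow H = {X - {x} | X x. X \<in> H \<and> x \<in> X}"

definition exchanges :: "'a set set \<Rightarrow> 'a set \<Rightarrow> 'a set" where
  "exchanges H D = {y. y \<notin> D \<and> insert y D \<in> H}"

lemma finite_shadow: "finite V \<Longrightarrow> H \<subseteq> Pow V \<Longrightarrow> finite (shadow H)"
  by (rule finite_subset[of _ "Pow V"]) (auto simp: shadow_def)

lemma finite_exchanges: "finite V \<Longrightarrow> H \<subseteq> Pow V \<Longrightarrow> finite (exchanges H D)"
  by (rule finite_subset[of _ V]) (auto simp: exchanges_def)

text \<open>
  As long as some set \<open>D\<close> of the shadow has at most \<open>M\<close> extensions in \<open>H\<close>, remove these extensions.
  This costs at most \<open>M\<close> members and takes \<open>D\<close> out of the shadow, so the process stops before all
  members are used up.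
\<close>

lemma large_codegree_subfamily:
  assumes "finite V" "H \<subseteq> Pow V" "M * card (shadow H) < card H"
  shows "\<exists>H'\<subseteq>H. H' \<noteq> {} \<and> (\<forall>X\<in>H'. \<forall>x\<in>X. M < card (exchanges H' (X - {x})))"
  using assms(2,3)
proof (induction "card H" arbitrary: H rule: less_induct)
  case less
  have finH: "finite H" using assms(1) less.prems(1) by (rule finite_family)
  show ?case
  proof (cases "\<forall>X\<in>H. \<forall>x\<in>X. M < card (exchanges H (X - {x}))")
    case True
    then show ?thesis using less.prems(2) by (intro exI[of _ H]) auto
  next
    case False
    then obtain X x where X: "X \<in> H" "x \<in> X" and le: "card (exchanges H (X - {x})) \<le> M"
      by (meson not_less)
    define D where "D = X - {x}"
    define R where "R = (\<lambda>y. insert y D) ` exchanges H D"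
    have fin: "finite (exchanges H D)" using assms(1) less.prems(1) by (rule finite_exchanges)
    have R: "finite R" "R \<subseteq> H" "card R \<le> M"
      using fin le card_image_le[OF fin, of "\<lambda>y. insert y D"] by (auto simp: R_def D_def exchanges_def)
    have "X \<in> R" using X by (auto simp: R_def exchanges_def D_def insert_absorb intro!: image_eqI[of _ _ x])
    then have lt: "card (H - R) < card H"
      using X finH by (intro psubset_card_mono) auto
    have sub: "shadow (H - R) \<subseteq> shadow H - {D}"
    proof
      fix Z assume "Z \<in> shadow (H - R)"
      then obtain Y y where Y: "Y \<in> H" "Y \<notin> R" "y \<in> Y" "Z = Y - {y}" by (auto simp: shadow_def)
      have "Z \<noteq> D"
      proof
        assume "Z = D"
        then have "Y = insert y D" "y \<notin> D" using Y by auto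
        then show False using Y by (auto simp: R_def exchanges_def)
      qed
      then show "Z \<in> shadow H - {D}" using Y by (auto simp: shadow_def)
    qed
    have fs: "finite (shadow H)" using assms(1) less.prems(1) by (rule finite_shadow)
    have D: "D \<in> shadow H" using X by (auto simp: shadow_def D_def)
    have "card (shadow (H - R)) \<le> card (shadow H - {D})" using sub fs by (intro card_mono) auto
    then have "card (shadow (H - R)) + 1 \<le> card (shadow H)"
      using D fs by (metis Suc_eq_plus1 Suc_le_mono card_Suc_Diff1)
    then have "M * card (shadow (H - R)) + M \<le> M * card (shadow H)"
      by (metis mult_le_mono2 distrib_left mult.right_neutral)
    moreover have "card H - M \<le> card (H - R)" using R finH by (simp add: card_Diff_subset)
    ultimately have "M * card (shadow (H - R)) < card (H - R)" using less.prems(2) by linarith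
    then obtain H' where "H' \<subseteq> H - R" "H' \<noteq> {}"
        "\<forall>X\<in>H'. \<forall>x\<in>X. M < card (exchanges H' (X - {x}))"
      using less.hyps[OF lt] less.prems(1) by blast
    then show ?thesis by blast
  qed
qed

lemma large_codegree_uniform:
  assumes fin: "finite V" and H: "H \<subseteq> Pow V" and unif: "\<And>X. X \<in> H \<Longrightarrow> card X = Suc r"
    and large: "M * (card V + 1) ^ r < card H"
  obtains H' where "H' \<subseteq> H" "H' \<noteq> {}"
    "\<And>X x B. X \<in> H' \<Longrightarrow> x \<in> X \<Longrightarrow> finite B \<Longrightarrow> card B \<le> M \<Longrightarrow>
       \<exists>y. y \<notin> B \<and> y \<notin> X - {x} \<and> insert y (X - {x}) \<in> H'"
proof -
  have "shadow H \<subseteq> {D. D \<subseteq> V \<and> card D = r}"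
    using H unif by (auto simp: shadow_def)
  then have "card (shadow H) \<le> card {D. D \<subseteq> V \<and> card D = r}"
    using fin by (intro card_mono) auto
  also have "\<dots> \<le> (card V + 1) ^ r" using fin by (rule card_subsets_le) simp
  finally have "M * card (shadow H) \<le> M * (card V + 1) ^ r" by (rule mult_le_mono2)
  then have "M * card (shadow H) < card H" using large by (rule le_less_trans)
  from large_codegree_subfamily[OF fin H this] obtain H'
    where H': "H' \<subseteq> H" "H' \<noteq> {}"
      and deg0: "\<forall>X\<in>H'. \<forall>x\<in>X. M < card (exchanges H' (X - {x}))"
    by (elim exE conjE) (rule that)
  have deg: "M < card (exchanges H' (X - {x}))" if "X \<in> H'" "x \<in> X" for X x
    using deg0 that by simp
  have "\<exists>y. y \<notin> B \<and> y \<notin> X - {x} \<and> insert y (X - {x}) \<in> H'"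
    if X: "X \<in> H'" "x \<in> X" and B: "finite B" "card B \<le> M" for X x B
  proof -
    have "\<not> exchanges H' (X - {x}) \<subseteq> B"
      using deg[OF X] B card_mono[OF B(1), of "exchanges H' (X - {x})"] by linarith
    then show ?thesis by (auto simp: exchanges_def)
  qed
  then show ?thesis by (rule that[OF H'])
qed

text \<open>
  Start with an edge \<open>{a, b, c, d}\<close> of a subfamily with large codegrees and exchange \<open>a\<close> for \<open>a'\<close>.
  From \<open>{a, b, c, d}\<close> exchange \<open>b\<close> for \<open>p\<close>, or \<open>c\<close> for \<open>q\<close>; from \<open>{a', b, c, d}\<close> exchange \<open>b\<close> for
  \<open>s\<close>, or \<open>d\<close> for \<open>t\<close>. In the four edges obtained in this way the new vertices \<open>p\<close>, \<open>q\<close>, \<open>s\<close>, \<open>t\<close>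
  have the four singleton labels, \<open>a\<close> and \<open>a'\<close> have complementary labels of size two, and the labels
  of \<open>b\<close>, \<open>c\<close>, \<open>d\<close> are \<open>{1, 3}\<close>, \<open>{0, 2, 3}\<close>, \<open>{0, 1, 2}\<close>. A tenth vertex \<open>z\<close> lies outside.
  A new vertex has to avoid at most nine others, hence the codegrees above \<open>9\<close>.
\<close>

lemma uniform4_ten_regions:
  fixes H :: "'a set set"
  assumes fin: "finite V" and H: "H \<subseteq> Pow V" and unif: "\<And>X. X \<in> H \<Longrightarrow> card X = 4"
    and large: "9 * (card V + 1) ^ 3 < card H"
  shows "has_regions 4 10 V H"
proof -
  have unif': "card X = Suc 3" if "X \<in> H" for X using unif[OF that] by simp
  obtain H' where H': "H' \<subseteq> H" "H' \<noteq> {}" and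
    ex: "\<And>X x B. X \<in> H' \<Longrightarrow> x \<in> X \<Longrightarrow> finite B \<Longrightarrow> card B \<le> 9 \<Longrightarrow>
       \<exists>y. y \<notin> B \<and> y \<notin> X - {x} \<and> insert y (X - {x}) \<in> H'"
    using large_codegree_uniform[OF fin H unif' large] by blast
  have new: "\<exists>y. y \<notin> set bs \<and> insert y (X - {x}) \<in> H'"
    if "X \<in> H'" "x \<in> X" "length bs \<le> 9" for X x bs
    using ex[of X x "set bs"] that card_length[of bs] by auto
  obtain X where X: "X \<in> H'" using H'(2) by blast
  then have "card X = 4" using unif H'(1) by blast
  then obtain a b c d where "X = {a, b, c, d}" and dist: "a \<noteq> b" "a \<noteq> c" "a \<noteq> d" "b \<noteq> c" "b \<noteq> d" "c \<noteq> d"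
    by (auto simp: numeral_eq_Suc card_Suc_eq)
  with X have X: "{a, b, c, d} \<in> H'" by simp
  obtain a' where a': "a' \<notin> {a, b, c, d}" "insert a' ({a, b, c, d} - {a}) \<in> H'"
    using new[OF X, of a "[a, b, c, d]"] by auto
  then have X': "{a', b, c, d} \<in> H'" using dist by (simp add: insert_Diff_if)
  obtain p where p: "p \<notin> {a, b, c, d, a'}" "insert p ({a, b, c, d} - {b}) \<in> H'"
    using new[OF X, of b "[a, b, c, d, a']"] by auto
  then have 1: "{p, a, c, d} \<in> H'" using dist by (simp add: insert_Diff_if)
  obtain q where q: "q \<notin> {a, b, c, d, a', p}" "insert q ({a, b, c, d} - {c}) \<in> H'"
    using new[OF X, of c "[a, b, c, d, a', p]"] by auto
  then have 2: "{q, a, b, d} \<in> H'" using dist by (simp add: insert_Diff_if)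
  obtain s where s: "s \<notin> {a, b, c, d, a', p, q}" "insert s ({a', b, c, d} - {b}) \<in> H'"
    using new[OF X', of b "[a, b, c, d, a', p, q]"] by auto
  then have 3: "{s, a', c, d} \<in> H'" using dist a'(1) by (simp add: insert_Diff_if)
  obtain t where t: "t \<notin> {a, b, c, d, a', p, q, s}" "insert t ({a', b, c, d} - {d}) \<in> H'"
    using new[OF X', of d "[a, b, c, d, a', p, q, s]"] by auto
  then have 4: "{t, a', b, c} \<in> H'" using dist a'(1) by (simp add: insert_Diff_if)
  obtain z where z: "z \<notin> {a, b, c, d, a', p, q, s, t}" "insert z ({a, b, c, d} - {a}) \<in> H'"
    using new[OF X, of a "[a, b, c, d, a', p, q, s, t]"] by auto
  define E where "E i = (if i = 0 then {p, a, c, d} else if i = 1 then {q, a, b, d}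
     else if i = 2 then {s, a', c, d} else {t, a', b, c})" for i :: nat
  have label4: "label 4 E x = (if x \<in> E 0 then {0} else {}) \<union> (if x \<in> E 1 then {1} else {})
     \<union> (if x \<in> E 2 then {2} else {}) \<union> (if x \<in> E 3 then {3} else {})" for x
  proof (rule set_eqI)
    fix i :: nat
    consider "i = 0" | "i = 1" | "i = 2" | "i = 3" | "i \<ge> 4" by linarith
    then show "i \<in> label 4 E x \<longleftrightarrow> i \<in> (if x \<in> E 0 then {0} else {}) \<union> (if x \<in> E 1 then {1} else {})
        \<union> (if x \<in> E 2 then {2} else {}) \<union> (if x \<in> E 3 then {3} else {})"
      by cases (simp_all add: label_def)
  qed
  have inV: "{a, b, c, d, a', p, q, s, t, z} \<subseteq> V"
    using X X' 1 2 3 4 z(2) H'(1) H by auto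
  have D: "distinct [a, b, c, d, a', p, q, s, t, z]"
    using dist a'(1) p(1) q(1) s(1) t(1) z(1) by auto
  have "label 4 E a = {0, 1}" "label 4 E b = {1, 3}" "label 4 E c = {0, 2, 3}" "label 4 E d = {0, 1, 2}"
    "label 4 E a' = {2, 3}" "label 4 E p = {0}" "label 4 E q = {1}" "label 4 E s = {2}" "label 4 E t = {3}"
    "label 4 E z = {}"
    unfolding label4 E_def using D by auto
  note labels = this
  define f where "f L = (0 \<in> L, 1 \<in> L, 2 \<in> L, 3 \<in> L)" for L :: "nat set"
  have "f ` label 4 E ` {a, b, c, d, a', p, q, s, t, z} =
     {(True, True, False, False), (False, True, False, True), (True, False, True, True),
      (True, True, True, False), (False, False, True, True), (True, False, False, False),
      (False, True, False, False), (False, False, True, False), (False, False, False, True),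
      (False, False, False, False)}"
    by (simp only: image_insert image_empty labels) (simp add: f_def)
  moreover have "card {(True, True, False, False), (False, True, False, True), (True, False, True, True),
      (True, True, True, False), (False, False, True, True), (True, False, False, False),
      (False, True, False, False), (False, False, True, False), (False, False, False, True),
      (False, False, False, False)} = 10" by simp
  moreover have "card (f ` label 4 E ` {a, b, c, d, a', p, q, s, t, z}) \<le> card (f ` label 4 E ` V)"
    using inV by (intro card_mono image_mono) auto
  moreover have "card (f ` label 4 E ` V) \<le> card (label 4 E ` V)" by (rule card_image_le) simp
  ultimately have "10 \<le> card (label 4 E ` V)" by simp
  moreover have "E i \<in> H" if "i < 4" for i
    using 1 2 3 4 H'(1) by (auto simp: E_def)
  ultimately show ?thesis unfolding has_regions_def by (intro exI[of _ E]) simp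
qed

lemma two_power_ge: "k \<ge> 3 \<Longrightarrow> 2 * k + 2 \<le> (2::nat) ^ k"
proof (induction k rule: dec_induct)
  case (step k)
  then show ?case by simp
qed simp

text \<open>
  For \<open>k \<ge> 4\<close> there are too few sets of size \<open>2 ^ (k - 1)\<close> to matter, because
  \<open>2 ^ (k - 1) \<le> 2 ^ k - 2 * k + 1\<close>. For \<open>k = 3\<close> this inequality just fails.
\<close>

lemma uniform_has_regions:
  assumes k: "k \<ge> 3" and fin: "finite V" and H: "H \<subseteq> Pow V"
    and unif: "\<And>X. X \<in> H \<Longrightarrow> card X = 2 ^ (k - 1)"
    and no: "\<not> has_regions (Suc k) (2 ^ k + 2) V H"
  shows "card H \<le> 9 * (card V + 1) ^ (2 ^ k - 2 * k + 1)"
proof (cases "k = 3")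
  case True
  then show ?thesis using uniform4_ten_regions[OF fin H] unif no by fastforce
next
  case False
  define d :: nat where "d = 2 ^ k - 2 * k + 1"
  obtain j where j: "k = Suc j" "j \<ge> 3" using k False by (cases k) auto
  have "2 ^ (k - 1) \<le> d" using two_power_ge[OF j(2)] j(1) by (simp add: d_def)
  have "card H \<le> card {D. D \<subseteq> V \<and> card D = 2 ^ (k - 1)}"
    using H unif fin by (intro card_mono) auto
  also have "\<dots> \<le> (card V + 1) ^ d" by (rule card_subsets_le) fact+
  also have "\<dots> \<le> 9 * (card V + 1) ^ d" by simp
  finally show ?thesis by (simp add: d_def)
qed

text \<open>
  With \<open>d = 2 ^ k - 2 * k + 1\<close>, the exponent \<open>d\<close> buys \<open>2 ^ k + 2\<close> regions of \<open>k + 1\<close> sets, and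
  \<open>2 ^ k - 2\<close> free vertices supply the others.
\<close>

lemma poly_bdd_Venn_step:
  assumes k: "k \<ge> 3"
    and VD: "poly_bdd (has_regions k (2 ^ k) :: 'a set \<Rightarrow> _) (2 ^ k - 2 * k + 1)"
  shows "poly_bdd (has_regions (Suc k) (2 ^ Suc k) :: 'a set \<Rightarrow> _) (2 ^ Suc k - 2 * Suc k + 1)"
proof -
  define d :: nat where "d = 2 ^ k - 2 * k + 1"
  have "poly_bdd (has_regions (Suc k) (2 ^ k + 2) :: 'a set \<Rightarrow> _) d"
    unfolding d_def
  proof (rule reduction_to_uniform[where k = k and K = 9])
    show "poly_bdd (has_regions k (2 ^ k) :: 'a set \<Rightarrow> _) (2 ^ k - 2 * k + 1)" by (rule VD)
  next
    fix V W :: "'a set" and H H'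
    assume "W \<subseteq> V" "H' \<subseteq> H" "has_regions (Suc k) (2 ^ k + 2) W ((\<lambda>E. E \<inter> W) ` H')"
    then show "has_regions (Suc k) (2 ^ k + 2) V H" by (rule has_regions_quotient)
  next
    fix V :: "'a set" and H
    assume "H \<subseteq> Pow V" "has_regions (Suc k) (2 ^ k + 2) V ((\<lambda>X. V - X) ` H)"
    then show "has_regions (Suc k) (2 ^ k + 2) V H" by (rule has_regions_compl)
  next
    fix V :: "'a set" and H
    assume "finite V" "H \<subseteq> Pow V" "\<And>X. X \<in> H \<Longrightarrow> card X = 2 ^ (k - 1)"
      "\<not> has_regions (Suc k) (2 ^ k + 2) V H"
    then show "card H \<le> 9 * (card V + 1) ^ (2 ^ k - 2 * k + 1)" by (rule uniform_has_regions[OF k])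
  qed (use k in simp_all)
  then have "poly_bdd (has_regions (Suc k) (2 ^ k + 2 + (2 ^ k - 2)) :: 'a set \<Rightarrow> _) (d + (2 ^ k - 2))"
    by (rule poly_bdd_add_regions) (use two_power_ge[OF k] in simp)
  moreover have "2 ^ k + 2 + (2 ^ k - 2) = (2::nat) ^ Suc k" "d + (2 ^ k - 2) = 2 ^ Suc k - 2 * Suc k + 1"
    using two_power_ge[OF k] by (simp_all add: d_def)
  ultimately show ?thesis by (simp only:)
qed

section \<open>Two sets, and branching members\<close>

lemma has_regions_2I:
  assumes "A \<in> H" "B \<in> H" "m \<le> card ((\<lambda>x. (x \<in> A, x \<in> B)) ` V)"
  shows "has_regions 2 m V H"
proof -
  define E where "E i = (if i = 0 then A else B)" for i :: nat
  have "(\<lambda>L. (0 \<in> L, 1 \<in> L)) ` label 2 E ` V = (\<lambda>x. (x \<in> A, x \<in> B)) ` V"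
    unfolding image_image by (intro image_cong refl) (auto simp: label_def E_def)
  then have "m \<le> card (label 2 E ` V)"
    using assms(3) card_image_le[of "label 2 E ` V" "\<lambda>L. (0 \<in> L, 1 \<in> L)"] by simp
  then show ?thesis using assms(1,2) unfolding has_regions_def
    by (intro exI[of _ E]) (simp add: E_def)
qed

lemma has_regions_3I:
  assumes "A \<in> H" "B \<in> H" "C \<in> H" "T \<subseteq> (\<lambda>x. (x \<in> A, x \<in> B, x \<in> C)) ` V" "m \<le> card T"
  shows "has_regions 3 m V H"
proof -
  define E where "E i = (if i = 0 then A else if i = 1 then B else C)" for i :: nat
  have "(\<lambda>L. (0 \<in> L, 1 \<in> L, 2 \<in> L)) ` label 3 E ` V = (\<lambda>x. (x \<in> A, x \<in> B, x \<in> C)) ` V"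
    unfolding image_image by (intro image_cong refl) (auto simp: label_def E_def)
  moreover have "finite ((\<lambda>x. (x \<in> A, x \<in> B, x \<in> C)) ` V)" by (rule finite_subset[OF subset_UNIV]) simp
  ultimately have "card T \<le> card ((\<lambda>L. (0 \<in> L, 1 \<in> L, 2 \<in> L)) ` label 3 E ` V)"
    using assms(4) by (simp only: card_mono)
  also have "\<dots> \<le> card (label 3 E ` V)" by (rule card_image_le) simp
  finally have "m \<le> card (label 3 E ` V)" using assms(5) by simp
  then show ?thesis using assms(1-3) unfolding has_regions_def
    by (intro exI[of _ E]) (simp add: E_def)
qed

text \<open>
  If two sets have at most two regions, then one of them is trivial or they are equal or complementary.
  So five sets contain two with three regions, and a free vertex gives the fourth.
\<close>

lemma poly_bdd_two_sets: "poly_bdd (has_regions 2 (2 ^ 2) :: 'a set \<Rightarrow> _) 1"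
proof -
  have "card H \<le> 4" if fin: "finite V" and H: "H \<subseteq> Pow V" and no: "\<not> has_regions 2 3 V H"
    for V and H :: "'a set set"
  proof -
    have "\<exists>X. H \<subseteq> {{}, V, X, V - X}"
    proof (cases "H \<subseteq> {{}, V}")
      case False
      then obtain X where X: "X \<in> H" "X \<noteq> {}" "X \<noteq> V" by blast
      then obtain x y where xy: "x \<in> X" "y \<in> V" "y \<notin> X" using H by blast
      have xV: "x \<in> V" using X H xy by blast
      have "Y \<in> {{}, V, X, V - X}" if Y: "Y \<in> H" for Y
      proof (rule ccontr)
        assume not4: "Y \<notin> {{}, V, X, V - X}"
        have YV: "Y \<subseteq> V" "X \<subseteq> V" using Y X H by auto
        have "\<exists>z\<in>V. \<exists>u\<in>V. (z \<in> X \<longleftrightarrow> u \<in> X) \<and> z \<in> Y \<and> u \<notin> Y"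
        proof (rule ccontr)
          assume "\<not> ?thesis"
          then have *: "z \<in> Y \<longleftrightarrow> (if z \<in> X then x \<in> Y else y \<in> Y)" if "z \<in> V" for z
            using that xy xV by (cases "z \<in> X") auto
          have "Y = {} \<or> Y = V \<or> Y = X \<or> Y = V - X"
          proof (cases "x \<in> Y")
            case True
            then have "z \<in> Y \<longleftrightarrow> z \<in> X \<or> y \<in> Y" if "z \<in> V" for z using *[OF that] by simp
            then show ?thesis using YV by (cases "y \<in> Y") blast+
          next
            case False
            then have "z \<in> Y \<longleftrightarrow> z \<notin> X \<and> y \<in> Y" if "z \<in> V" for z using *[OF that] by simp
            then show ?thesis using YV by (cases "y \<in> Y") blast+
          qed
          then show False using not4 by simp
        qed
        then obtain z u where zu: "z \<in> V" "u \<in> V" "z \<in> X \<longleftrightarrow> u \<in> X" "z \<in> Y" "u \<notin> Y" by blast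
        define e where "e = (if z \<in> X then y else x)"
        have e: "e \<in> V" "e \<in> X \<longleftrightarrow> z \<notin> X" using xy xV by (auto simp: e_def)
        have "card ((\<lambda>x. (x \<in> X, x \<in> Y)) ` {z, u, e}) \<le> card ((\<lambda>x. (x \<in> X, x \<in> Y)) ` V)"
          using fin zu e by (intro card_mono) auto
        moreover have "card ((\<lambda>x. (x \<in> X, x \<in> Y)) ` {z, u, e}) = 3"
          using zu e by (simp add: card_insert_if)
        ultimately show False using no has_regions_2I[OF X(1) Y, of 3 V] by simp
      qed
      then show ?thesis by blast
    qed blast
    then obtain X where "H \<subseteq> {{}, V, X, V - X}" by blast
    then have "card H \<le> card {{}, V, X, V - X}" by (intro card_mono) auto
    also have "\<dots> \<le> 4" using card_length[of "[{}, V, X, V - X]"] by simp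
    finally show ?thesis .
  qed
  then have "poly_bdd (has_regions 2 3 :: 'a set \<Rightarrow> _) 0"
    unfolding poly_bdd_def by (intro exI[of _ 4]) simp
  from poly_bdd_add_regions[OF this, of 1] show ?thesis by simp
qed

text \<open>
  The model is an edge \<open>Z = {x, y}\<close> of a graph \<open>G\<close> in which \<open>x\<close> and \<open>y\<close> have many other neighbours.
  Here \<open>x\<close> and \<open>y\<close> are replaced by the nonempty sets \<open>P True\<close> and \<open>P False\<close>, and the neighbours by the
  nonempty sets \<open>N True i\<close> and \<open>N False i\<close>. Nine neighbours on each side are enough for the
  choice in \<open>general_position\<close> below.
\<close>

definition branching :: "'a set set \<Rightarrow> 'a set \<Rightarrow> bool" where
  "branching G Z \<longleftrightarrow> (\<exists>P N. Z = P True \<union> P False \<and> P True \<inter> P False = {} \<and> (\<forall>s. P s \<noteq> {}) \<and>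
     (\<forall>s. \<forall>i<9::nat. P s \<union> N s i \<in> G \<and> N s i \<noteq> {} \<and> N s i \<inter> Z = {}) \<and>
     (\<forall>s t. \<forall>i<9::nat. \<forall>j<9::nat. (s, i) \<noteq> (t, j) \<longrightarrow> N s i \<inter> N t j = {}))"

lemma branchingE:
  assumes "branching G Z"
  obtains P :: "bool \<Rightarrow> 'a set" and N :: "bool \<Rightarrow> nat \<Rightarrow> 'a set" where "Z = P True \<union> P False" "P True \<inter> P False = {}" "\<And>s. P s \<noteq> {}"
    "\<And>s i. i < 9 \<Longrightarrow> P s \<union> N s i \<in> G" "\<And>s i. i < 9 \<Longrightarrow> N s i \<noteq> {}"
    "\<And>s i. i < 9 \<Longrightarrow> N s i \<inter> Z = {}"
    "\<And>s t i j. i < 9 \<Longrightarrow> j < 9 \<Longrightarrow> (s, i) \<noteq> (t, j) \<Longrightarrow> N s i \<inter> N t j = {}"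
proof -
  obtain P N where *: "Z = P True \<union> P False" "P True \<inter> P False = {}" "\<forall>s. P s \<noteq> {}"
     "\<forall>s. \<forall>i<9::nat. P s \<union> N s i \<in> G \<and> N s i \<noteq> {} \<and> N s i \<inter> Z = {}"
     "\<forall>s t. \<forall>i<9::nat. \<forall>j<9::nat. (s, i) \<noteq> (t, j) \<longrightarrow> N s i \<inter> N t j = {}"
    using assms unfolding branching_def by (elim exE conjE) (rule that)
  show thesis
  proof (rule that[of P N])
    show "P s \<noteq> {}" for s using *(3) by simp
    show "P s \<union> N s i \<in> G" "N s i \<noteq> {}" "N s i \<inter> Z = {}" if "i < 9" for s i
      using *(4) that by simp_all
    show "N s i \<inter> N t j = {}" if "i < 9" "j < 9" "(s, i) \<noteq> (t, j)" for s t i j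
      using that by (rule *(5)[rule_format])
  qed (fact *(1) *(2))+
qed

lemma branchingI:
  fixes P :: "bool \<Rightarrow> 'a set" and N :: "bool \<Rightarrow> nat \<Rightarrow> 'a set"
  assumes "Z = P True \<union> P False" "P True \<inter> P False = {}" "\<And>s. P s \<noteq> {}"
    "\<And>s i. i < 9 \<Longrightarrow> P s \<union> N s i \<in> G" "\<And>s i. i < 9 \<Longrightarrow> N s i \<noteq> {}"
    "\<And>s i. i < 9 \<Longrightarrow> N s i \<inter> Z = {}"
    "\<And>s t i j. i < 9 \<Longrightarrow> j < 9 \<Longrightarrow> (s, i) \<noteq> (t, j) \<Longrightarrow> N s i \<inter> N t j = {}"
  shows "branching G Z"
  unfolding branching_def
  by (rule exI[of _ P], rule exI[of _ N], intro conjI allI impI) (rule assms; assumption)+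

lemma branching_mono:
  assumes "branching G Z" "G \<subseteq> G'"
  shows "branching G' Z"
proof -
  obtain P :: "bool \<Rightarrow> 'a set" and N :: "bool \<Rightarrow> nat \<Rightarrow> 'a set" where *: "Z = P True \<union> P False" "P True \<inter> P False = {}" "\<And>s. P s \<noteq> {}"
    "\<And>s i. i < 9 \<Longrightarrow> P s \<union> N s i \<in> G" "\<And>s i. i < 9 \<Longrightarrow> N s i \<noteq> {}"
    "\<And>s i. i < 9 \<Longrightarrow> N s i \<inter> Z = {}"
    "\<And>s t i j. i < 9 \<Longrightarrow> j < 9 \<Longrightarrow> (s, i) \<noteq> (t, j) \<Longrightarrow> N s i \<inter> N t j = {}"
    using assms(1) by (rule branchingE) (rule that)
  have "P s \<union> N s i \<in> G'" if "i < 9" for s i using *(4)[OF that] assms(2) by blast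
  then show ?thesis by (rule branchingI[OF *(1-3) _ *(5-7)])
qed

text \<open>
  Apart from the nonemptiness of some intersections, branching says that certain Boolean combinations
  of members are empty, and this can be checked on \<open>W\<close> because every point of \<open>V\<close> has a twin there.
  The part \<open>P s\<close> is recovered as the intersection of \<open>Z\<close> with a member, and \<open>N s i\<close> as a difference.
\<close>

lemma branching_quotient:
  assumes W: "W \<subseteq> V" and G: "G \<subseteq> Pow V" and Z: "Z \<in> G"
    and twin: "\<And>x. x \<in> V \<Longrightarrow> \<exists>w\<in>W. \<forall>E\<in>G. x \<in> E \<longleftrightarrow> w \<in> E"
    and branching: "branching ((\<lambda>E. E \<inter> W) ` G) (Z \<inter> W)"
  shows "branching G Z"
proof -
  obtain P :: "bool \<Rightarrow> 'a set" and N :: "bool \<Rightarrow> nat \<Rightarrow> 'a set" where *: "Z \<inter> W = P True \<union> P False" "P True \<inter> P False = {}" "\<And>s. P s \<noteq> {}"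
    "\<And>s i. i < 9 \<Longrightarrow> P s \<union> N s i \<in> (\<lambda>E. E \<inter> W) ` G" "\<And>s i. i < 9 \<Longrightarrow> N s i \<noteq> {}"
    "\<And>s i. i < 9 \<Longrightarrow> N s i \<inter> (Z \<inter> W) = {}"
    "\<And>s t i j. i < 9 \<Longrightarrow> j < 9 \<Longrightarrow> (s, i) \<noteq> (t, j) \<Longrightarrow> N s i \<inter> N t j = {}"
    using branching by (rule branchingE) (rule that)
  define X where "X s i = (SOME X. X \<in> G \<and> X \<inter> W = P s \<union> N s i)" for s i
  have X: "X s i \<in> G \<and> X s i \<inter> W = P s \<union> N s i" if "i < 9" for s i
  proof -
    have "\<exists>Y. Y \<in> G \<and> Y \<inter> W = P s \<union> N s i" using *(4)[OF that, of s] by auto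
    then show ?thesis unfolding X_def by (rule someI_ex)
  qed
  have Psub: "P s \<subseteq> Z" for s using *(1) by (cases s) auto
  have "X s i \<inter> Z \<inter> W = P s" "(X s i - Z) \<inter> W = N s i" if "i < 9" for s i
  proof -
    have "X s i \<inter> W = P s \<union> N s i" "N s i \<inter> (Z \<inter> W) = {}" "P s \<subseteq> Z \<inter> W"
      using X[OF that, of s] *(6)[OF that, of s] *(1) by (auto split: if_splits) (cases s; simp)+
    then show "X s i \<inter> Z \<inter> W = P s" "(X s i - Z) \<inter> W = N s i" by blast+
  qed
  note inW = this
  \<comment> \<open>to prove a pointwise statement about members of \<open>G\<close>, replace the point by its twin in \<open>W\<close>\<close>
  have eqI: "x \<in> V \<Longrightarrow> (\<And>w. w \<in> W \<Longrightarrow> (\<forall>E\<in>G. x \<in> E \<longleftrightarrow> w \<in> E) \<Longrightarrow> R) \<Longrightarrow> R" for x R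
    using twin by blast
  have inter: "X s i \<inter> Z = X s 0 \<inter> Z" if i: "i < 9" for s i
  proof -
    have "x \<in> X s i \<inter> Z \<longleftrightarrow> x \<in> X s 0 \<inter> Z" if x: "x \<in> V" for x
      using x
    proof (rule eqI)
      fix w assume w: "w \<in> W" "\<forall>E\<in>G. x \<in> E \<longleftrightarrow> w \<in> E"
      have "w \<in> X s i \<inter> Z \<longleftrightarrow> w \<in> X s 0 \<inter> Z" using inW(1)[OF i, of s] inW(1)[of 0 s] w(1) by auto
      then show ?thesis using w(2) X[OF i, of s] X[of 0 s] Z by auto
    qed
    then show ?thesis using Z G by blast
  qed
  define P' where "P' s = X s 0 \<inter> Z" for s
  define N' where "N' s i = X s i - Z" for s i
  have PN: "P' s \<union> N' s i = X s i" if "i < 9" for s i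
    using inter[OF that, of s] by (auto simp: P'_def N'_def)
  have "Z = P' True \<union> P' False"
  proof -
    have "x \<in> Z \<longrightarrow> x \<in> P' True \<union> P' False" if x: "x \<in> V" for x
      using x
    proof (rule eqI)
      fix w assume w: "w \<in> W" "\<forall>E\<in>G. x \<in> E \<longleftrightarrow> w \<in> E"
      have "w \<in> Z \<longrightarrow> w \<in> X True 0 \<or> w \<in> X False 0"
        using *(1) inW(1)[of 0 True] inW(1)[of 0 False] w(1) by auto
      then show ?thesis using w(2) X[of 0 True] X[of 0 False] Z by (auto simp: P'_def)
    qed
    then show ?thesis using Z G by (auto simp: P'_def)
  qed
  moreover have "P' True \<inter> P' False = {}"
  proof -
    have "x \<notin> P' True \<inter> P' False" if x: "x \<in> V" for x
      using x
    proof (rule eqI)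
      fix w assume w: "w \<in> W" "\<forall>E\<in>G. x \<in> E \<longleftrightarrow> w \<in> E"
      have "\<not> (w \<in> X True 0 \<and> w \<in> X False 0 \<and> w \<in> Z)"
        using *(2) inW(1)[of 0 True] inW(1)[of 0 False] w(1) by auto
      then show ?thesis using w(2) X[of 0 True] X[of 0 False] Z by (auto simp: P'_def)
    qed
    then show ?thesis using Z G by (auto simp: P'_def)
  qed
  moreover have "P' s \<noteq> {}" for s using *(3)[of s] inW(1)[of 0 s] by (auto simp: P'_def)
  moreover have "P' s \<union> N' s i \<in> G" if "i < 9" for s i using PN[OF that] X[OF that] by metis
  moreover have "N' s i \<noteq> {}" if "i < 9" for s i
    using *(5)[OF that, of s] inW(2)[OF that, of s] by (auto simp: N'_def)
  moreover have "N' s i \<inter> Z = {}" for s i by (auto simp: N'_def)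
  moreover have "N' s i \<inter> N' t j = {}" if ij: "i < 9" "j < 9" "(s, i) \<noteq> (t, j)" for s t i j
  proof -
    have "x \<notin> N' s i \<inter> N' t j" if x: "x \<in> V" for x
      using x
    proof (rule eqI)
      fix w assume w: "w \<in> W" "\<forall>E\<in>G. x \<in> E \<longleftrightarrow> w \<in> E"
      have "\<not> (w \<in> X s i \<and> w \<in> X t j \<and> w \<notin> Z)"
        using *(7)[OF ij] inW(2)[of i s] inW(2)[of j t] w(1) ij by auto
      then show ?thesis using w(2) X[OF ij(1), of s] X[OF ij(2), of t] Z by (auto simp: N'_def)
    qed
    then show ?thesis using X[OF ij(1), of s] G by (auto simp: N'_def)
  qed
  ultimately show ?thesis by (rule branchingI)
qed

lemma choose_distinct:
  assumes "\<And>B. finite B \<Longrightarrow> card B \<le> M \<Longrightarrow> \<exists>y. y \<notin> B \<and> R y"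
    and "finite B" "card B + m \<le> M"
  shows "\<exists>f :: nat \<Rightarrow> 'a. inj_on f {..<m} \<and> (\<forall>i<m. f i \<notin> B \<and> R (f i))"
  using assms(3)
proof (induction m)
  case (Suc m)
  then obtain f :: "nat \<Rightarrow> 'a" where f: "inj_on f {..<m}" "\<forall>i<m. f i \<notin> B \<and> R (f i)" by auto
  have "card (B \<union> f ` {..<m}) \<le> M"
    using card_Un_le[of B "f ` {..<m}"] card_image_le[of "{..<m}" f] Suc.prems by simp
  then obtain y where y: "y \<notin> B \<union> f ` {..<m}" "R y"
    using assms(1)[of "B \<union> f ` {..<m}"] assms(2) by auto
  have "inj_on (f(m := y)) {..<Suc m}"
    using f(1) y(1) by (auto simp: inj_on_def less_Suc_eq)
  moreover have "\<forall>i<Suc m. (f(m := y)) i \<notin> B \<and> R ((f(m := y)) i)"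
    using f(2) y by (auto simp: less_Suc_eq)
  ultimately show ?case by blast
qed simp

text \<open>
  In a subgraph of minimum degree more than \<open>20\<close> every edge \<open>{x, y}\<close> is branching: besides \<open>x\<close> and
  \<open>y\<close> one has to choose \<open>9 + 9\<close> distinct neighbours.
\<close>

lemma graph_branching:
  assumes fin: "finite V" and H: "H \<subseteq> Pow V" and unif: "\<And>X. X \<in> H \<Longrightarrow> card X = 2"
    and large: "20 * (card V + 1) < card H"
  shows "\<exists>Z\<in>H. branching H Z"
proof -
  have unif': "card X = Suc 1" if "X \<in> H" for X using unif[OF that] by simp
  have large': "20 * (card V + 1) ^ 1 < card H" using large by simp
  obtain H' where H': "H' \<subseteq> H" "H' \<noteq> {}" and
    ex: "\<And>X x B. X \<in> H' \<Longrightarrow> x \<in> X \<Longrightarrow> finite B \<Longrightarrow> card B \<le> 20 \<Longrightarrow>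
       \<exists>y. y \<notin> B \<and> y \<notin> X - {x} \<and> insert y (X - {x}) \<in> H'"
    using large_codegree_uniform[OF fin H unif' large'] by blast
  obtain Z where Z: "Z \<in> H'" using H'(2) by blast
  then have "card Z = 2" using unif H'(1) by blast
  then obtain x y where xy: "Z = {x, y}" "x \<noteq> y" by (auto simp: card_2_iff)
  have nx: "\<exists>u. u \<notin> B \<and> {x, u} \<in> H" if "finite B" "card B \<le> 20" for B
  proof -
    have "Z - {y} = {x}" using xy by auto
    then show ?thesis using ex[OF Z, of y B] xy that H'(1) by (auto simp: insert_commute)
  qed
  have ny: "\<exists>u. u \<notin> B \<and> {y, u} \<in> H" if "finite B" "card B \<le> 20" for B
  proof -
    have "Z - {x} = {y}" using xy by auto
    then show ?thesis using ex[OF Z, of x B] xy that H'(1) by (auto simp: insert_commute)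
  qed
  have "card {x, y} + 9 \<le> 20" using xy by simp
  then obtain f where f: "inj_on f {..<9::nat}" "\<forall>i<9. f i \<notin> {x, y} \<and> {x, f i} \<in> H"
    using choose_distinct[where M = 20 and B = "{x, y}" and m = 9, OF nx] by auto
  have "card ({x, y} \<union> f ` {..<9}) + 9 \<le> 20"
    using card_Un_le[of "{x, y}" "f ` {..<9}"] card_image_le[of "{..<9}" f] xy by simp
  then obtain g where g: "inj_on g {..<9::nat}"
      "\<forall>i<9. g i \<notin> {x, y} \<union> f ` {..<9} \<and> {y, g i} \<in> H"
    using choose_distinct[where M = 20 and B = "{x, y} \<union> f ` {..<9}" and m = 9, OF ny] by auto
  have "branching H Z" unfolding branching_def
  proof (intro exI[of _ "\<lambda>s. if s then {x} else {y}"] exI[of _ "\<lambda>s i. if s then {f i} else {g i}"] conjI allI impI)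
    fix s t :: bool and i j :: nat assume ij: "i < 9" "j < 9" "(s, i) \<noteq> (t, j)"
    have "f i \<in> f ` {..<9}" "f j \<in> f ` {..<9}" using ij by auto
    then have "f i \<noteq> g j" "g i \<noteq> f j" using g(2) ij by (metis UnI2)+
    moreover have "i \<noteq> j \<longrightarrow> f i \<noteq> f j \<and> g i \<noteq> g j" using f(1) g(1) ij by (auto simp: inj_on_def)
    ultimately show "(if s then {f i} else {g i}) \<inter> (if t then {f j} else {g j}) = {}"
      using ij(3) by auto
  qed (use xy f g in \<open>auto simp: insert_commute\<close>)
  then show ?thesis using Z H'(1) by blast
qed

text \<open>
  The structure that is forced by linearly many sets. The disjunct on complements makes it invariant
  under complementation of all members.
\<close>

definition six_or_branching :: "'a set \<Rightarrow> 'a set set \<Rightarrow> bool" where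
  "six_or_branching V G \<longleftrightarrow> has_regions 3 6 V G \<or> (\<exists>Z\<in>G. branching G Z) \<or>
     (\<exists>Z\<in>G. branching ((\<lambda>X. V - X) ` G) (V - Z))"

lemma compl_compl: "G \<subseteq> Pow V \<Longrightarrow> (\<lambda>X. V - X) ` (\<lambda>X. V - X) ` G = G"
proof -
  assume "G \<subseteq> Pow V"
  then have "(\<lambda>X. V - (V - X)) ` G = (\<lambda>X. X) ` G" by (intro image_cong refl) auto
  then show ?thesis by (simp add: image_image)
qed

text \<open>
  The recursion for \<open>k = 2\<close>: six regions of three sets are those of two crossing sets and two more, and
  the uniform families that remain are graphs. Six regions alone are not forced by linearly many sets,
  as the edge sets of complete bipartite graphs show.
\<close>

lemma poly_bdd_six_or_branching: "poly_bdd (six_or_branching :: 'a set \<Rightarrow> _) 1"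
proof (rule reduction_to_uniform[where k = 2 and K = 20])
  show "poly_bdd (has_regions 2 (2 ^ 2) :: 'a set \<Rightarrow> _) 1" by (rule poly_bdd_two_sets)
next
  fix V :: "'a set" and H
  assume "has_regions (Suc 2) (2 ^ 2 + 2) V H"
  then have "has_regions 3 6 V H" by simp
  then show "six_or_branching V H" unfolding six_or_branching_def by (rule disjI1)
next
  fix V W :: "'a set" and H H'
  assume W: "W \<subseteq> V" and H: "H \<subseteq> Pow V" and H': "H' \<subseteq> H"
    and twin: "\<And>x. x \<in> V \<Longrightarrow> \<exists>w\<in>W. \<forall>E\<in>H'. x \<in> E \<longleftrightarrow> w \<in> E"
    and Q: "six_or_branching W ((\<lambda>E. E \<inter> W) ` H')"
  have H'V: "H' \<subseteq> Pow V" using H H' by blast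
  consider "has_regions 3 6 W ((\<lambda>E. E \<inter> W) ` H')"
    | Z where "Z \<in> H'" "branching ((\<lambda>E. E \<inter> W) ` H') (Z \<inter> W)"
    | Z where "Z \<in> H'" "branching ((\<lambda>X. W - X) ` (\<lambda>E. E \<inter> W) ` H') (W - Z \<inter> W)"
    using Q unfolding six_or_branching_def by blast
  then show "six_or_branching V H"
  proof cases
    case 1
    then show ?thesis unfolding six_or_branching_def using has_regions_quotient[OF W H'] by blast
  next
    case 2
    then have "branching H' Z" using branching_quotient[OF W H'V] twin by blast
    then show ?thesis unfolding six_or_branching_def using branching_mono[OF _ H'] 2(1) H' by blast
  next
    case 3
    define G where "G = (\<lambda>X. V - X) ` H'"
    have G: "G \<subseteq> Pow V" by (auto simp: G_def)
    have "(\<lambda>X. W - X) ` (\<lambda>E. E \<inter> W) ` H' = (\<lambda>E. E \<inter> W) ` G"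
      unfolding G_def image_image using W by (intro image_cong refl) auto
    moreover have "W - Z \<inter> W = (V - Z) \<inter> W" using W by auto
    ultimately have "branching ((\<lambda>E. E \<inter> W) ` G) ((V - Z) \<inter> W)" using 3(2) by simp
    moreover have "\<exists>w\<in>W. \<forall>E\<in>G. x \<in> E \<longleftrightarrow> w \<in> E" if "x \<in> V" for x
    proof -
      obtain w where "w \<in> W" "\<forall>E\<in>H'. x \<in> E \<longleftrightarrow> w \<in> E" using twin[OF \<open>x \<in> V\<close>] by blast
      then show ?thesis using that W by (intro bexI[of _ w]) (auto simp: G_def)
    qed
    moreover have "V - Z \<in> G" using 3(1) by (simp add: G_def)
    ultimately have "branching G (V - Z)" using branching_quotient[OF W G] by blast
    moreover have "G \<subseteq> (\<lambda>X. V - X) ` H" using H' by (auto simp: G_def)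
    ultimately have "branching ((\<lambda>X. V - X) ` H) (V - Z)" by (rule branching_mono)
    then show ?thesis unfolding six_or_branching_def using 3(1) H' by blast
  qed
next
  fix V :: "'a set" and H
  assume H: "H \<subseteq> Pow V" and Q: "six_or_branching V ((\<lambda>X. V - X) ` H)"
  have dbl: "V - (V - Z) = Z" if "Z \<in> H" for Z using that H by auto
  consider "has_regions 3 6 V ((\<lambda>X. V - X) ` H)"
    | Z where "Z \<in> H" "branching ((\<lambda>X. V - X) ` H) (V - Z)"
    | Z where "Z \<in> H" "branching ((\<lambda>X. V - X) ` (\<lambda>X. V - X) ` H) (V - (V - Z))"
    using Q unfolding six_or_branching_def by blast
  then show "six_or_branching V H"
  proof cases
    case 1
    then show ?thesis unfolding six_or_branching_def using has_regions_compl[OF H] by blast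
  next
    case 2
    then show ?thesis unfolding six_or_branching_def by blast
  next
    case 3
    then show ?thesis unfolding six_or_branching_def compl_compl[OF H] dbl[OF 3(1)] by blast
  qed
next
  fix V :: "'a set" and H
  assume H: "finite V" "H \<subseteq> Pow V" "\<And>X. X \<in> H \<Longrightarrow> card X = 2 ^ (2 - 1)" and no: "\<not> six_or_branching V H"
  have "\<not> 20 * (card V + 1) < card H"
  proof
    assume "20 * (card V + 1) < card H"
    then have "\<exists>Z\<in>H. branching H Z" using H by (intro graph_branching[of V H]) auto
    then show False using no unfolding six_or_branching_def by blast
  qed
  then show "card H \<le> 20 * (card V + 1) ^ 1" by simp
qed simp_all


section \<open>Branching edges when three sets have at most six regions\<close>

text \<open>
  Let \<open>Z = P \<union> Q\<close> be branching in the link of \<open>v\<close>, with neighbours \<open>P \<union> M\<close> and \<open>Q \<union> N\<close>. Suppose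
  that \<open>insert w Z\<close> is a member. The three sets \<open>P \<union> M\<close>, \<open>Q \<union> N\<close>, \<open>insert w Z\<close> have the labels of
  \<open>P\<close>, \<open>Q\<close>, \<open>M\<close>, \<open>N\<close>, \<open>w\<close> and the empty one, six in all. Since \<open>v\<close> may be added to the first two, it gives
  a seventh. The same works with \<open>insert w (insert v Z)\<close>, only the label of \<open>v\<close> is different.
\<close>

lemma branching_no_up:
  assumes G: "G \<subseteq> Pow V" and no: "\<not> has_regions 3 7 V G" and v: "v \<in> V"
    and Z: "branching (link v G) Z" and vZ: "v \<notin> Z" and w: "w \<notin> Z" "w \<noteq> v"
  shows "insert w Z \<notin> G" and "insert w (insert v Z) \<notin> G"
proof -
  obtain P :: "bool \<Rightarrow> 'a set" and N :: "bool \<Rightarrow> nat \<Rightarrow> 'a set" where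
    P: "Z = P True \<union> P False" "P True \<inter> P False = {}" "\<And>s. P s \<noteq> {}"
    and PN: "\<And>s i. i < 9 \<Longrightarrow> P s \<union> N s i \<in> link v G" and N: "\<And>s i. i < 9 \<Longrightarrow> N s i \<noteq> {}"
    "\<And>s i. i < 9 \<Longrightarrow> N s i \<inter> Z = {}"
    "\<And>s t i j. i < 9 \<Longrightarrow> j < 9 \<Longrightarrow> (s, i) \<noteq> (t, j) \<Longrightarrow> N s i \<inter> N t j = {}"
    using Z by (rule branchingE) (rule that)
  \<comment> \<open>at most one of the parts contains \<open>w\<close>\<close>
  have "\<exists>i<9. \<exists>i'<9. i \<noteq> i' \<and> w \<notin> N True i \<and> w \<notin> N True i'"
  proof (cases "w \<in> N True 0")
    case True
    then have "w \<notin> N True 1" "w \<notin> N True 2" using N(3)[of 0 1 True True] N(3)[of 0 2 True True] by auto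
    then show ?thesis by (intro exI[of _ 1] conjI exI[of _ 2]) simp_all
  next
    case 0: False
    show ?thesis
    proof (cases "w \<in> N True 1")
      case True
      then have "w \<notin> N True 2" using N(3)[of 1 2 True True] by auto
      then show ?thesis using 0 by (intro exI[of _ 0] conjI exI[of _ 2]) simp_all
    next
      case False
      then show ?thesis using 0 by (intro exI[of _ 0] conjI exI[of _ 1]) simp_all
    qed
  qed
  then obtain i i' where i: "i < 9" "i' < 9" "i \<noteq> i'" "w \<notin> N True i" "w \<notin> N True i'"
    by (elim exE conjE) (rule that)
  have "\<exists>j<9. w \<notin> N False j"
  proof (cases "w \<in> N False 0")
    case True
    then have "w \<notin> N False 1" using N(3)[of 0 1 False False] by auto
    then show ?thesis by (intro exI[of _ 1]) simp
  next
    case False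
    then show ?thesis by (intro exI[of _ 0]) simp
  qed
  then obtain j where j: "j < 9" "w \<notin> N False j" by blast
  define A where "A = insert v (P True \<union> N True i)"
  define B where "B = insert v (P False \<union> N False j)"
  have AB: "A \<in> G" "B \<in> G" using PN[OF i(1), of True] PN[OF j(1), of False] by (simp_all add: A_def B_def link_def)
  have vN: "v \<notin> N s l" if "l < 9" for s l using PN[OF that, of s] by (auto simp: link_def)
  \<comment> \<open>\<open>c\<close> lies in a part that is not used, which makes it a point outside all three sets\<close>
  obtain p q where p: "p \<in> P True" and q: "q \<in> P False" using P(3) by blast
  obtain a where a: "a \<in> N True i" using N(1)[OF i(1), of True] by blast
  obtain b where b: "b \<in> N False j" using N(1)[OF j(1), of False] by blast
  obtain c where c: "c \<in> N True i'" using N(1)[OF i(2), of True] by blast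
  have ab: "N True i \<inter> N False j = {}" "N True i' \<inter> N False j = {}" "N True i' \<inter> N True i = {}"
    using N(3)[OF i(1) j(1), of True False] N(3)[OF i(2) j(1), of True False]
      N(3)[OF i(2) i(1), of True True] i(3) by auto
  have Z': "N True i \<inter> Z = {}" "N True i' \<inter> Z = {}" "N False j \<inter> Z = {}" using N(2) i j by auto
  note vN' = vN[OF i(1), of True] vN[OF i(2), of True] vN[OF j(1), of False]
  have inV: "p \<in> V" "q \<in> V" "a \<in> V" "b \<in> V" "c \<in> V"
    using AB G p q a b c PN[OF i(2), of True] by (auto simp: A_def B_def link_def)
  have Pp: "p \<in> A" "p \<notin> B" "p \<in> Z" "q \<notin> A" "q \<in> B" "q \<in> Z" "a \<in> A" "a \<notin> B" "a \<notin> Z" "b \<notin> A" "b \<in> B" "b \<notin> Z"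
    "c \<notin> A" "c \<notin> B" "c \<notin> Z" "w \<notin> A" "w \<notin> B" "v \<in> A" "v \<in> B"
    "v \<noteq> p" "v \<noteq> q" "v \<noteq> a" "v \<noteq> b" "v \<noteq> c" "w \<noteq> a" "w \<noteq> b" "w \<noteq> c" "w \<noteq> p" "w \<noteq> q"
    using p q a b c P(1,2) ab Z' vZ w vN' i j unfolding A_def B_def by auto
  have seven: "has_regions 3 7 V G" if C: "C \<in> G" and CZ: "\<And>x. x \<noteq> v \<Longrightarrow> x \<in> C \<longleftrightarrow> x = w \<or> x \<in> Z" for C
  proof (rule has_regions_3I[OF AB C])
    have "w \<in> V" using C CZ[of w] w G by auto
    then show "(\<lambda>x. (x \<in> A, x \<in> B, x \<in> C)) ` {p, q, a, b, c, w, v} \<subseteq> (\<lambda>x. (x \<in> A, x \<in> B, x \<in> C)) ` V"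
      using inV v by (intro image_mono) auto
    have "p \<in> C" "q \<in> C" "a \<notin> C" "b \<notin> C" "c \<notin> C" "w \<in> C"
      using CZ Pp w by auto
    then show "7 \<le> card ((\<lambda>x. (x \<in> A, x \<in> B, x \<in> C)) ` {p, q, a, b, c, w, v})"
      using Pp by (cases "v \<in> C") simp_all
  qed
  show "insert w Z \<notin> G" "insert w (insert v Z) \<notin> G"
    using seven[of "insert w Z"] seven[of "insert w (insert v Z)"] no by auto
qed

text \<open>
  Three families of nine disjoint sets each; the members with indices \<open>a\<close>, \<open>b\<close>, \<open>c\<close> shall have private
  points \<open>x\<close>, \<open>y\<close>, \<open>z\<close>, and some further set of the first family shall have a point \<open>q\<close> outside all
  three. Fix a point in each set. Of the \<open>9 ^ 3\<close> triples at most \<open>8 * 9 ^ 2\<close> are bad: each of eight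
  conditions, that a certain point lies in a certain set, determines one of the three indices from the
  other two.
\<close>

lemma general_position:
  fixes N1 N2 N3 :: "nat \<Rightarrow> 'a set"
  assumes ne: "\<And>i. i < 9 \<Longrightarrow> N1 i \<noteq> {}" "\<And>i. i < 9 \<Longrightarrow> N2 i \<noteq> {}" "\<And>i. i < 9 \<Longrightarrow> N3 i \<noteq> {}"
    and d1: "\<And>i j. i < 9 \<Longrightarrow> j < 9 \<Longrightarrow> i \<noteq> j \<Longrightarrow> N1 i \<inter> N1 j = {}"
    and d2: "\<And>i j. i < 9 \<Longrightarrow> j < 9 \<Longrightarrow> i \<noteq> j \<Longrightarrow> N2 i \<inter> N2 j = {}"
    and d3: "\<And>i j. i < 9 \<Longrightarrow> j < 9 \<Longrightarrow> i \<noteq> j \<Longrightarrow> N3 i \<inter> N3 j = {}"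
  obtains a b c a' x y z q where "a < 9" "b < 9" "c < 9" "a' < 9"
    "x \<in> N1 a" "x \<notin> N2 b" "x \<notin> N3 c" "y \<notin> N1 a" "y \<in> N2 b" "y \<notin> N3 c"
    "z \<notin> N1 a" "z \<notin> N2 b" "z \<in> N3 c" "q \<in> N1 a'" "q \<notin> N1 a" "q \<notin> N2 b" "q \<notin> N3 c"
proof -
  define r1 where "r1 i = (SOME x. x \<in> N1 i)" for i
  define r2 where "r2 i = (SOME x. x \<in> N2 i)" for i
  define r3 where "r3 i = (SOME x. x \<in> N3 i)" for i
  have r: "r1 i \<in> N1 i" "r2 i \<in> N2 i" "r3 i \<in> N3 i" if "i < 9" for i
    using ne[OF that] unfolding r1_def r2_def r3_def by (simp_all add: some_in_eq)
  define s :: "nat \<Rightarrow> nat" where "s a = (if a = 0 then 1 else 0)" for a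
  have s: "s a < 9" "s a \<noteq> a" for a by (simp_all add: s_def)
  define I :: "nat set" where "I = {..<9}"
  define T where "T = I \<times> I \<times> I"
  have bad: "card S \<le> 81" if "S \<subseteq> T" "inj_on f S" "f ` S \<subseteq> I \<times> I" for S and f :: "nat \<times> nat \<times> nat \<Rightarrow> nat \<times> nat"
  proof -
    have "card S \<le> card (I \<times> I)" using that(2,3) by (rule card_inj_on_le) (simp add: I_def)
    then show ?thesis by (simp add: I_def)
  qed
  have uniq: "i = j" if "x \<in> N i" "x \<in> N j" "i \<in> I" "j \<in> I" "\<And>i j. i < 9 \<Longrightarrow> j < 9 \<Longrightarrow> i \<noteq> j \<Longrightarrow> N i \<inter> N j = {}"
    for x i j and N :: "nat \<Rightarrow> 'a set"
    using that by (metis I_def disjoint_iff lessThan_iff)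
  define S where "S = [{(a, b, c) \<in> T. r1 a \<in> N2 b}, {(a, b, c) \<in> T. r1 a \<in> N3 c},
    {(a, b, c) \<in> T. r2 b \<in> N1 a}, {(a, b, c) \<in> T. r2 b \<in> N3 c},
    {(a, b, c) \<in> T. r3 c \<in> N1 a}, {(a, b, c) \<in> T. r3 c \<in> N2 b},
    {(a, b, c) \<in> T. r1 (s a) \<in> N2 b}, {(a, b, c) \<in> T. r1 (s a) \<in> N3 c}]"
  have "card {(a, b, c) \<in> T. r1 a \<in> N2 b} \<le> 81"
    by (rule bad[where f = "\<lambda>(a, b, c). (a, c)"]) (auto simp: T_def inj_on_def intro: uniq[OF _ _ _ _ d2])
  moreover have "card {(a, b, c) \<in> T. r1 a \<in> N3 c} \<le> 81"
    by (rule bad[where f = "\<lambda>(a, b, c). (a, b)"]) (auto simp: T_def inj_on_def intro: uniq[OF _ _ _ _ d3])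
  moreover have "card {(a, b, c) \<in> T. r2 b \<in> N1 a} \<le> 81"
    by (rule bad[where f = "\<lambda>(a, b, c). (b, c)"]) (auto simp: T_def inj_on_def intro: uniq[OF _ _ _ _ d1])
  moreover have "card {(a, b, c) \<in> T. r2 b \<in> N3 c} \<le> 81"
    by (rule bad[where f = "\<lambda>(a, b, c). (a, b)"]) (auto simp: T_def inj_on_def intro: uniq[OF _ _ _ _ d3])
  moreover have "card {(a, b, c) \<in> T. r3 c \<in> N1 a} \<le> 81"
    by (rule bad[where f = "\<lambda>(a, b, c). (b, c)"]) (auto simp: T_def inj_on_def intro: uniq[OF _ _ _ _ d1])
  moreover have "card {(a, b, c) \<in> T. r3 c \<in> N2 b} \<le> 81"
    by (rule bad[where f = "\<lambda>(a, b, c). (a, c)"]) (auto simp: T_def inj_on_def intro: uniq[OF _ _ _ _ d2])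
  moreover have "card {(a, b, c) \<in> T. r1 (s a) \<in> N2 b} \<le> 81"
    by (rule bad[where f = "\<lambda>(a, b, c). (a, c)"]) (auto simp: T_def inj_on_def intro: uniq[OF _ _ _ _ d2])
  moreover have "card {(a, b, c) \<in> T. r1 (s a) \<in> N3 c} \<le> 81"
    by (rule bad[where f = "\<lambda>(a, b, c). (a, b)"]) (auto simp: T_def inj_on_def intro: uniq[OF _ _ _ _ d3])
  ultimately have le: "\<forall>X \<in> set S. card X \<le> 81" by (simp add: S_def)
  have "card (\<Union>(set S)) \<le> (\<Sum>X\<in>set S. card X)"
    using card_UN_le[of "set S" id] by simp
  also have "\<dots> \<le> card (set S) * 81" using le sum_bounded_above[of "set S" card 81] by simp
  also have "\<dots> \<le> 8 * 81" using card_length[of S] by (intro mult_le_mono1) (simp add: S_def)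
  finally have "card (\<Union>(set S)) < card T" by (simp add: T_def I_def)
  moreover have "finite (\<Union>(set S))" by (rule finite_subset[of _ T]) (auto simp: S_def T_def I_def)
  ultimately have "\<not> T \<subseteq> \<Union>(set S)" using card_mono[of "\<Union>(set S)" T] by (meson not_le)
  then obtain t where t: "t \<in> T" "t \<notin> \<Union>(set S)" by blast
  obtain a b c where abc: "t = (a, b, c)" by (cases t) auto
  show thesis
  proof (rule that[of a b c "s a" "r1 a" "r2 b" "r3 c" "r1 (s a)"])
    show 9: "a < 9" "b < 9" "c < 9" "s a < 9" using t(1) s by (simp_all add: T_def abc I_def)
    show "r1 a \<in> N1 a" "r2 b \<in> N2 b" "r3 c \<in> N3 c" "r1 (s a) \<in> N1 (s a)" using r 9 by auto
    show "r1 (s a) \<notin> N1 a" using d1[OF 9(4) 9(1) s(2)] r(1)[OF 9(4)] by blast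
  qed (use t in \<open>auto simp: S_def abc\<close>)
qed

text \<open>
  Labels of points with respect to three sets are written as triples of truth values. The label of a
  point in at least two of the sets cannot coincide with that of a private point or of a point outside.
\<close>

definition two_true :: "bool \<times> bool \<times> bool \<Rightarrow> bool" where
  "two_true = (\<lambda>(p, q, r). p \<and> q \<or> p \<and> r \<or> q \<and> r)"

lemma seven_labels:
  assumes "two_true l1" "two_true l2" "two_true l3" "l1 \<noteq> l2" "l1 \<noteq> l3" "l2 \<noteq> l3"
  shows "card {(True, False, False), (False, True, False), (False, False, True), (False, False, False), l1, l2, l3} = 7"
proof -
  define B where "B = {(True, False, False), (False, True, False), (False, False, True), (False, False, False)}"
  have B: "finite B" "card B = 4" by (simp_all add: B_def)
  have "l \<notin> B" if "two_true l" for l using that by (auto simp: B_def two_true_def)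
  then have "card (insert l1 (insert l2 (insert l3 B))) = 7" using assms B by simp
  moreover have "{(True, False, False), (False, True, False), (False, False, True), (False, False, False), l1, l2, l3}
     = insert l1 (insert l2 (insert l3 B))" by (auto simp: B_def)
  ultimately show ?thesis by simp
qed

text \<open>
  For \<open>three_lower_neighbours\<close>: each \<open>E - {v\<^sub>i}\<close> is split into two sides, and \<open>tij\<close> tells on which side
  of the \<open>i\<close>-th splitting \<open>v\<^sub>j\<close> lies. Choose a side \<open>si\<close> of each splitting, and decide by \<open>fi\<close> whether
  \<open>v\<^sub>i\<close> is added to the \<open>i\<close>-th set. One can achieve that the labels of \<open>v\<^sub>1\<close>, \<open>v\<^sub>2\<close>, \<open>v\<^sub>3\<close>
  are distinct and have size at least two.
\<close>

lemma choose_sides: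
  fixes t12 t13 t21 t23 t31 t32 :: bool
  shows "\<exists>s1 s2 s3 f1 f2 f3.
     two_true (f1, t21 = s2, t31 = s3) \<and> two_true (t12 = s1, f2, t32 = s3) \<and> two_true (t13 = s1, t23 = s2, f3) \<and>
     (f1, t21 = s2, t31 = s3) \<noteq> (t12 = s1, f2, t32 = s3) \<and>
     (f1, t21 = s2, t31 = s3) \<noteq> (t13 = s1, t23 = s2, f3) \<and>
     (t12 = s1, f2, t32 = s3) \<noteq> (t13 = s1, t23 = s2, f3)"
  unfolding two_true_def by (cases t12; cases t13; cases t21; cases t23; cases t31; cases t32) (simp_all add: ex_bool_eq)

text \<open>
  A set \<open>E\<close> has at most two lower neighbours \<open>E - {v}\<close> that are branching in the link of \<open>v\<close>. Given three,
  take a side of each of the three splittings together with one of its neighbouring parts. The parts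
  contribute three private points and a point outside, hence four labels of size at most one, and the
  three vertices themselves contribute three labels of size at least two.
\<close>

lemma three_lower_neighbours:
  assumes G: "G \<subseteq> Pow V" and no: "\<not> has_regions 3 7 V G"
    and v: "v1 \<in> V" "v2 \<in> V" "v3 \<in> V" "v1 \<in> E" "v2 \<in> E" "v3 \<in> E" "v1 \<noteq> v2" "v1 \<noteq> v3" "v2 \<noteq> v3"
    and br: "branching (link v1 G) (E - {v1})" "branching (link v2 G) (E - {v2})" "branching (link v3 G) (E - {v3})"
  shows False
proof -
  obtain P1 :: "bool \<Rightarrow> 'a set" and N1 :: "bool \<Rightarrow> nat \<Rightarrow> 'a set" where 1:
    "E - {v1} = P1 True \<union> P1 False" "P1 True \<inter> P1 False = {}" "\<And>s. P1 s \<noteq> {}"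
    "\<And>s i. i < 9 \<Longrightarrow> P1 s \<union> N1 s i \<in> link v1 G" "\<And>s i. i < 9 \<Longrightarrow> N1 s i \<noteq> {}"
    "\<And>s i. i < 9 \<Longrightarrow> N1 s i \<inter> (E - {v1}) = {}"
    "\<And>s t i j. i < 9 \<Longrightarrow> j < 9 \<Longrightarrow> (s, i) \<noteq> (t, j) \<Longrightarrow> N1 s i \<inter> N1 t j = {}"
    using br(1) by (rule branchingE) (rule that)
  obtain P2 :: "bool \<Rightarrow> 'a set" and N2 :: "bool \<Rightarrow> nat \<Rightarrow> 'a set" where 2:
    "E - {v2} = P2 True \<union> P2 False" "P2 True \<inter> P2 False = {}" "\<And>s. P2 s \<noteq> {}"
    "\<And>s i. i < 9 \<Longrightarrow> P2 s \<union> N2 s i \<in> link v2 G" "\<And>s i. i < 9 \<Longrightarrow> N2 s i \<noteq> {}"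
    "\<And>s i. i < 9 \<Longrightarrow> N2 s i \<inter> (E - {v2}) = {}"
    "\<And>s t i j. i < 9 \<Longrightarrow> j < 9 \<Longrightarrow> (s, i) \<noteq> (t, j) \<Longrightarrow> N2 s i \<inter> N2 t j = {}"
    using br(2) by (rule branchingE) (rule that)
  obtain P3 :: "bool \<Rightarrow> 'a set" and N3 :: "bool \<Rightarrow> nat \<Rightarrow> 'a set" where 3:
    "E - {v3} = P3 True \<union> P3 False" "P3 True \<inter> P3 False = {}" "\<And>s. P3 s \<noteq> {}"
    "\<And>s i. i < 9 \<Longrightarrow> P3 s \<union> N3 s i \<in> link v3 G" "\<And>s i. i < 9 \<Longrightarrow> N3 s i \<noteq> {}"
    "\<And>s i. i < 9 \<Longrightarrow> N3 s i \<inter> (E - {v3}) = {}"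
    "\<And>s t i j. i < 9 \<Longrightarrow> j < 9 \<Longrightarrow> (s, i) \<noteq> (t, j) \<Longrightarrow> N3 s i \<inter> N3 t j = {}"
    using br(3) by (rule branchingE) (rule that)
  have side: "u \<in> P s \<longleftrightarrow> (u \<in> P True) = s" if "u \<in> P True \<union> P False" "P True \<inter> P False = {}"
    for u s and P :: "bool \<Rightarrow> 'a set"
    using that by (cases s) auto
  have in1: "v2 \<in> P1 s \<longleftrightarrow> (v2 \<in> P1 True) = s" "v3 \<in> P1 s \<longleftrightarrow> (v3 \<in> P1 True) = s" for s
    using v 1(1,2) by (auto intro!: side)
  have in2: "v1 \<in> P2 s \<longleftrightarrow> (v1 \<in> P2 True) = s" "v3 \<in> P2 s \<longleftrightarrow> (v3 \<in> P2 True) = s" for s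
    using v 2(1,2) by (auto intro!: side)
  have in3: "v1 \<in> P3 s \<longleftrightarrow> (v1 \<in> P3 True) = s" "v2 \<in> P3 s \<longleftrightarrow> (v2 \<in> P3 True) = s" for s
    using v 3(1,2) by (auto intro!: side)
  obtain s1 s2 s3 f1 f2 f3 where L:
    "two_true (f1, v1 \<in> P2 s2, v1 \<in> P3 s3)" "two_true (v2 \<in> P1 s1, f2, v2 \<in> P3 s3)"
    "two_true (v3 \<in> P1 s1, v3 \<in> P2 s2, f3)"
    "(f1, v1 \<in> P2 s2, v1 \<in> P3 s3) \<noteq> (v2 \<in> P1 s1, f2, v2 \<in> P3 s3)"
    "(f1, v1 \<in> P2 s2, v1 \<in> P3 s3) \<noteq> (v3 \<in> P1 s1, v3 \<in> P2 s2, f3)"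
    "(v2 \<in> P1 s1, f2, v2 \<in> P3 s3) \<noteq> (v3 \<in> P1 s1, v3 \<in> P2 s2, f3)"
    using choose_sides[of "v1 \<in> P2 True" "v1 \<in> P3 True" "v2 \<in> P1 True" "v2 \<in> P3 True" "v3 \<in> P1 True" "v3 \<in> P2 True"]
    unfolding in1[symmetric] in2[symmetric] in3[symmetric] by (elim exE conjE) (rule that)
  obtain a b c a' x y z q where abc: "a < 9" "b < 9" "c < 9" "a' < 9"
    and x: "x \<in> N1 s1 a" "x \<notin> N2 s2 b" "x \<notin> N3 s3 c" and y: "y \<notin> N1 s1 a" "y \<in> N2 s2 b" "y \<notin> N3 s3 c"
    and z: "z \<notin> N1 s1 a" "z \<notin> N2 s2 b" "z \<in> N3 s3 c"
    and q: "q \<in> N1 s1 a'" "q \<notin> N1 s1 a" "q \<notin> N2 s2 b" "q \<notin> N3 s3 c"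
    by (rule general_position[of "N1 s1" "N2 s2" "N3 s3"])
      (use 1(5) 2(5) 3(5) in blast, use 1(5) 2(5) 3(5) in blast, use 1(5) 2(5) 3(5) in blast,
       rule 1(7), assumption, assumption, simp, rule 2(7), assumption, assumption, simp,
       rule 3(7), assumption, assumption, simp, rule that)
  define A1 where "A1 = (if f1 then insert v1 (P1 s1 \<union> N1 s1 a) else P1 s1 \<union> N1 s1 a)"
  define A2 where "A2 = (if f2 then insert v2 (P2 s2 \<union> N2 s2 b) else P2 s2 \<union> N2 s2 b)"
  define A3 where "A3 = (if f3 then insert v3 (P3 s3 \<union> N3 s3 c) else P3 s3 \<union> N3 s3 c)"
  have mem: "A1 \<in> G" "A2 \<in> G" "A3 \<in> G"
    using 1(4)[OF abc(1), of s1] 2(4)[OF abc(2), of s2] 3(4)[OF abc(3), of s3]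
    by (simp_all add: A1_def A2_def A3_def link_def)
  have new: "v1 \<notin> P1 s1" "v1 \<notin> N1 s1 a" "v1 \<notin> N1 s1 a'" "v2 \<notin> P2 s2" "v2 \<notin> N2 s2 b" "v3 \<notin> P3 s3" "v3 \<notin> N3 s3 c"
    using 1(4)[OF abc(1), of s1] 1(4)[OF abc(4), of s1] 2(4)[OF abc(2), of s2] 3(4)[OF abc(3), of s3]
    by (simp_all add: link_def)
  have "P1 True \<union> P1 False \<subseteq> E" "P2 True \<union> P2 False \<subseteq> E" "P3 True \<union> P3 False \<subseteq> E"
    unfolding 1(1)[symmetric] 2(1)[symmetric] 3(1)[symmetric] by (rule Diff_subset)+
  then have Psub: "P1 s1 \<subseteq> E" "P2 s2 \<subseteq> E" "P3 s3 \<subseteq> E"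
    by (cases s1, simp_all, cases s2, simp_all, cases s3, simp_all)
  have off: "N \<inter> E = {}" if "N \<inter> (E - {v}) = {}" "v \<notin> N" for N and v :: 'a using that by blast
  have Nout: "N1 s1 a \<inter> E = {}" "N1 s1 a' \<inter> E = {}" "N2 s2 b \<inter> E = {}" "N3 s3 c \<inter> E = {}"
    by (rule off[OF 1(6)[OF abc(1)] new(2)] off[OF 1(6)[OF abc(4)] new(3)]
      off[OF 2(6)[OF abc(2)] new(5)] off[OF 3(6)[OF abc(3)] new(7)])+
  have inV: "x \<in> V" "y \<in> V" "z \<in> V" "q \<in> V"
    using mem G x y z q 1(4)[OF abc(4), of s1] by (auto simp: A1_def A2_def A3_def link_def split: if_splits)
  have out: "x \<notin> E" "y \<notin> E" "z \<notin> E" "q \<notin> E" using x y z q Nout by blast+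
  then have "x \<in> A1" "x \<notin> A2" "x \<notin> A3" "y \<notin> A1" "y \<in> A2" "y \<notin> A3" "z \<notin> A1" "z \<notin> A2" "z \<in> A3"
    "q \<notin> A1" "q \<notin> A2" "q \<notin> A3"
    using x y z q Psub v(4-6) unfolding A1_def A2_def A3_def by auto
  moreover have "v1 \<in> A1 \<longleftrightarrow> f1" "v1 \<in> A2 \<longleftrightarrow> v1 \<in> P2 s2" "v1 \<in> A3 \<longleftrightarrow> v1 \<in> P3 s3"
    "v2 \<in> A1 \<longleftrightarrow> v2 \<in> P1 s1" "v2 \<in> A2 \<longleftrightarrow> f2" "v2 \<in> A3 \<longleftrightarrow> v2 \<in> P3 s3"
    "v3 \<in> A1 \<longleftrightarrow> v3 \<in> P1 s1" "v3 \<in> A2 \<longleftrightarrow> v3 \<in> P2 s2" "v3 \<in> A3 \<longleftrightarrow> f3"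
    using new v(4-) Nout unfolding A1_def A2_def A3_def by auto
  ultimately have labels: "(\<lambda>x. (x \<in> A1, x \<in> A2, x \<in> A3)) ` {x, y, z, q, v1, v2, v3} =
    {(True, False, False), (False, True, False), (False, False, True), (False, False, False),
     (f1, v1 \<in> P2 s2, v1 \<in> P3 s3), (v2 \<in> P1 s1, f2, v2 \<in> P3 s3), (v3 \<in> P1 s1, v3 \<in> P2 s2, f3)}"
    by (simp only: image_insert image_empty simp_thms)
  have "has_regions 3 7 V G"
  proof (rule has_regions_3I[OF mem])
    show "(\<lambda>x. (x \<in> A1, x \<in> A2, x \<in> A3)) ` {x, y, z, q, v1, v2, v3} \<subseteq> (\<lambda>x. (x \<in> A1, x \<in> A2, x \<in> A3)) ` V"
      using inV v by (intro image_mono) auto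
    show "7 \<le> card ((\<lambda>x. (x \<in> A1, x \<in> A2, x \<in> A3)) ` {x, y, z, q, v1, v2, v3})"
      unfolding labels using seven_labels[OF L] by simp
  qed
  then show False using no by blast
qed

text \<open>
  Pairs \<open>(v, Z)\<close> stand for the edges from \<open>Z\<close> up to \<open>insert v Z\<close> in the Hasse diagram of \<open>G\<close>.
\<close>

definition up_edges :: "'a set \<Rightarrow> 'a set set \<Rightarrow> ('a \<times> 'a set) set" where
  "up_edges V G = (SIGMA v:V. {Z \<in> link v G. branching (link v G) Z})"

lemma finite_up_edges: "finite V \<Longrightarrow> finite G \<Longrightarrow> finite (up_edges V G)"
  by (auto simp: up_edges_def link_def)

text \<open>
  Orient the edges upwards. By \<open>branching_no_up\<close> each set is the lower end of at most one edge, and a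
  set that is an upper end is not a lower end. By \<open>three_lower_neighbours\<close> each set is the upper end of
  at most two edges. So with \<open>e\<close> edges there are \<open>e\<close> lower ends and at least \<open>e / 2\<close> upper ends, and
  all of them are different members of \<open>G\<close>.
\<close>

lemma card_up_edges:
  assumes fin: "finite V" and G: "G \<subseteq> Pow V" and no: "\<not> has_regions 3 7 V G"
  shows "3 * card (up_edges V G) \<le> 2 * card G"
proof -
  define S where "S = up_edges V G"
  define up where "up = (\<lambda>(v, Z). insert v Z) ` S"
  have finG: "finite G" using fin G by (rule finite_family)
  have finS: "finite S" unfolding S_def using fin finG by (rule finite_up_edges)
  have S: "v \<in> V" "Z \<in> G" "v \<notin> Z" "insert v Z \<in> G" "branching (link v G) Z" if "(v, Z) \<in> S" for v Z
    using that by (auto simp: S_def up_edges_def link_def)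
  have "inj_on snd S"
  proof (rule inj_onI, clarsimp)
    fix v w Z assume vZ: "(v, Z) \<in> S" and wZ: "(w, Z) \<in> S"
    show "v = w"
      using branching_no_up(1)[OF G no S(1)[OF vZ] S(5)[OF vZ] S(3)[OF vZ] S(3)[OF wZ]] S(4)[OF wZ] by blast
  qed
  then have card_low: "card (snd ` S) = card S" by (rule card_image)
  have disj: "snd ` S \<inter> up = {}"
  proof (rule ccontr)
    assume "snd ` S \<inter> up \<noteq> {}"
    then obtain v w Y where vZ: "(v, insert w Y) \<in> S" and wY: "(w, Y) \<in> S" by (auto simp: up_def)
    have "v \<notin> Y" "v \<noteq> w" using S(3)[OF vZ] by auto
    then show False
      using branching_no_up(2)[OF G no S(1)[OF wY] S(5)[OF wY] S(3)[OF wY]] S(4)[OF vZ] by blast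
  qed
  have fibre: "card {e \<in> S. (\<lambda>(v, Z). insert v Z) e = E} \<le> 2" for E
  proof (rule ccontr)
    define F where "F = {e \<in> S. (\<lambda>(v, Z). insert v Z) e = E}"
    assume "\<not> ?thesis"
    then have "3 \<le> card F" by (simp add: F_def)
    then obtain T where T: "T \<subseteq> F" "card T = 3" by (rule obtain_subset_with_card_n)
    from T(2) obtain e1 e2 e3 where T3: "T = {e1, e2, e3}" and ne3: "e1 \<noteq> e2" "e2 \<noteq> e3" "e1 \<noteq> e3"
      unfolding card_3_iff by (elim exE conjE) (rule that)
    have e: "e1 \<in> F" "e2 \<in> F" "e3 \<in> F" using T(1) T3 by simp_all
    have F: "fst e \<in> V" "fst e \<in> E" "branching (link (fst e) G) (E - {fst e})" "e = (fst e, E - {fst e})"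
      if "e \<in> F" for e
    proof -
      obtain v Z where e_eq: "e = (v, Z)" by (cases e)
      then have vZ: "e = (v, Z)" "(v, Z) \<in> S" "insert v Z = E" using that by (simp_all add: F_def)
      then have "Z = E - {v}" using S(3)[OF vZ(2)] by auto
      then show "fst e \<in> V" "fst e \<in> E" "branching (link (fst e) G) (E - {fst e})" "e = (fst e, E - {fst e})"
        using vZ S[OF vZ(2)] by auto
    qed
    have ne: "fst e \<noteq> fst e'" if "e \<in> F" "e' \<in> F" "e \<noteq> e'" for e e'
      using F(4)[OF that(1)] F(4)[OF that(2)] that(3) by auto
    show False
      by (rule three_lower_neighbours[OF G no F(1)[OF e(1)] F(1)[OF e(2)] F(1)[OF e(3)]
          F(2)[OF e(1)] F(2)[OF e(2)] F(2)[OF e(3)] ne[OF e(1,2) ne3(1)] ne[OF e(1,3) ne3(3)] ne[OF e(2,3) ne3(2)]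
          F(3)[OF e(1)] F(3)[OF e(2)] F(3)[OF e(3)]])
  qed
  have finup: "finite up" using finS by (simp add: up_def)
  have "card S \<le> card (\<Union>E\<in>up. {e \<in> S. (\<lambda>(v, Z). insert v Z) e = E})"
    using finS finup by (intro card_mono) (auto simp: up_def)
  also have "\<dots> \<le> (\<Sum>E\<in>up. card {e \<in> S. (\<lambda>(v, Z). insert v Z) e = E})" by (rule card_UN_le[OF finup])
  also have "\<dots> \<le> (\<Sum>E\<in>up. 2)" by (rule sum_mono) (rule fibre)
  finally have S2: "card S \<le> 2 * card up" by simp
  have "snd ` S \<union> up \<subseteq> G" using S by (auto simp: up_def)
  then have "card (snd ` S \<union> up) \<le> card G" using finG by (intro card_mono)
  moreover have "card (snd ` S \<union> up) = card S + card up"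
    using finS finup disj card_low by (simp add: card_Un_disjoint)
  ultimately show ?thesis using S2 unfolding S_def[symmetric] by linarith
qed

lemma link_compl:
  assumes "G \<subseteq> Pow V" "v \<in> V"
  shows "link v ((\<lambda>X. V - X) ` G) = (\<lambda>X. (V - {v}) - X) ` link v G"
proof (intro equalityI subsetI)
  fix Y assume Y: "Y \<in> link v ((\<lambda>X. V - X) ` G)"
  then obtain X1 X2 where X: "X1 \<in> G" "Y = V - X1" "X2 \<in> G" "insert v Y = V - X2" "v \<notin> Y"
    by (auto simp: link_def)
  then have "X1 = insert v X2" "v \<notin> X2" "Y = (V - {v}) - X2" using assms by auto
  then show "Y \<in> (\<lambda>X. (V - {v}) - X) ` link v G" using X by (auto simp: link_def)
next
  fix Y assume "Y \<in> (\<lambda>X. (V - {v}) - X) ` link v G"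
  then obtain X where X: "X \<in> G" "v \<notin> X" "insert v X \<in> G" "Y = (V - {v}) - X" by (auto simp: link_def)
  then have "Y = V - insert v X" "insert v Y = V - X" "v \<notin> Y" using assms by auto
  then show "Y \<in> link v ((\<lambda>X. V - X) ` G)" using X by (auto simp: link_def)
qed

text \<open>
  Let \<open>g = card G\<close> exceed \<open>C * (n + 1) ^ 2\<close>, with \<open>n\<close> as small as possible. By minimality each link has
  at least \<open>g - C * n ^ 2\<close> sets, so the link sizes add up to at least about \<open>2 * g\<close>. In each link all but
  \<open>C0 * n\<close> sets are branching or have branching complements, and \<open>card_up_edges\<close>, applied to \<open>G\<close> and to
  the family of complements, allows at most \<open>4 / 3 * g\<close> such sets in all links together.
\<close>

lemma poly_bdd_three_sets: "poly_bdd (has_regions 3 7 :: 'a set \<Rightarrow> _) 2"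
proof -
  obtain C0 where C0: "\<And>V H :: 'a set set. finite V \<Longrightarrow> H \<subseteq> Pow V \<Longrightarrow> \<not> six_or_branching V H \<Longrightarrow>
      card H \<le> C0 * (card V + 1)"
    using poly_bdd_six_or_branching unfolding poly_bdd_def power_one_right by blast
  define C where "C = 3 * C0 + 32"
  have "card G \<le> C * (card V + 1) ^ 2"
    if "finite V" "G \<subseteq> Pow V" "\<not> has_regions 3 7 V G" for V and G :: "'a set set"
    using that
  proof (induction "card V" arbitrary: V G rule: less_induct)
    case less
    note fin = \<open>finite V\<close> and G = \<open>G \<subseteq> Pow V\<close> and no = \<open>\<not> has_regions 3 7 V G\<close>
    have finG: "finite G" using fin G by (rule finite_family)
    define n where "n = card V"
    define g where "g = card G"
    define Gc where "Gc = (\<lambda>X. V - X) ` G"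
    have Gc: "Gc \<subseteq> Pow V" "finite Gc" using finG by (auto simp: Gc_def)
    have inj: "inj_on (\<lambda>X. V - X) G" using G by (intro inj_onI) blast
    have noc: "\<not> has_regions 3 7 V Gc" using has_regions_compl[OF G] no unfolding Gc_def by blast
    show ?case
    proof (rule ccontr)
      assume "\<not> ?case"
      then have big: "C * (n + 1) ^ 2 < g" by (simp add: n_def g_def)
      \<comment> \<open>for smaller \<open>n\<close> there are at most \<open>32\<close> sets at all; the final estimate needs \<open>n \<ge> 6\<close>\<close>
      have n6: "6 \<le> n"
      proof (rule ccontr)
        assume "\<not> 6 \<le> n"
        have "g \<le> card (Pow V)" unfolding g_def using fin G by (intro card_mono) auto
        also have "\<dots> = 2 ^ n" using fin by (simp add: card_Pow n_def)
        also have "\<dots> \<le> 2 ^ 5" using \<open>\<not> 6 \<le> n\<close> by (intro power_increasing) auto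
        also have "\<dots> \<le> C * 1" by (simp add: C_def)
        also have "\<dots> \<le> C * (n + 1) ^ 2" by (intro mult_le_mono2) (simp add: one_le_power)
        finally show False using big by simp
      qed
      define S1 where "S1 v = {Z \<in> link v G. branching (link v G) Z}" for v
      define S2 where "S2 v = {Z \<in> link v Gc. branching (link v Gc) Z}" for v
      have vert: "g \<le> C * n ^ 2 + (card (S1 v) + card (S2 v) + C0 * n)" if v: "v \<in> V" for v
      proof -
        define L where "L = link v G"
        define U where "U = V - {v}"
        have U: "finite U" "U \<subseteq> V" "card U + 1 = n" "card U < card V"
          using fin card_Suc_Diff1[OF fin v] by (auto simp: U_def n_def)
        have L: "L \<subseteq> Pow U" unfolding L_def U_def using G by (rule link_subset_Pow)
        have finL: "finite L" using U(1) L by (rule finite_family)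
        have "\<not> has_regions 3 7 U ((\<lambda>E. E \<inter> U) ` G)" using has_regions_trace[OF U(2)] no by blast
        then have "card ((\<lambda>E. E \<inter> U) ` G) \<le> C * (card U + 1) ^ 2"
          using U by (intro less.hyps) auto
        then have del: "card ((\<lambda>E. E - {v}) ` G) \<le> C * n ^ 2"
          using trace_delete[OF G, of v] U(3) by (simp add: U_def)
        define T where "T = {Z \<in> L. branching ((\<lambda>X. U - X) ` L) (U - Z)}"
        define R where "R = {Z \<in> L. \<not> branching L Z \<and> \<not> branching ((\<lambda>X. U - X) ` L) (U - Z)}"
        have RL: "R \<subseteq> L" by (auto simp: R_def)
        have "\<not> has_regions 3 6 U L"
          using has_regions_link[OF fin G v, of 3 6] no unfolding U_def L_def by auto
        then have "\<not> has_regions 3 6 U R" using has_regions_mono[OF _ RL] by blast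
        moreover have "\<not> branching R Z" if "Z \<in> R" for Z
          using branching_mono[OF _ RL] that by (auto simp: R_def)
        moreover have "\<not> branching ((\<lambda>X. U - X) ` R) (U - Z)" if "Z \<in> R" for Z
          using branching_mono[OF _ image_mono[OF RL]] that by (auto simp: R_def)
        ultimately have "\<not> six_or_branching U R" unfolding six_or_branching_def by blast
        then have "card R \<le> C0 * n" using C0[OF U(1), of R] RL L U(3) by auto
        moreover have "card T \<le> card (S2 v)"
        proof -
          have "inj_on (\<lambda>X. U - X) T" using L by (intro inj_onI) (auto simp: T_def)
          moreover have "(\<lambda>X. U - X) ` T \<subseteq> S2 v"
            unfolding S2_def Gc_def link_compl[OF G v] U_def[symmetric] L_def[symmetric]
            by (auto simp: T_def)
          moreover have "finite (S2 v)" using Gc(2) by (simp add: S2_def link_def)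
          ultimately show ?thesis by (rule card_inj_on_le)
        qed
        moreover have "card L \<le> card (S1 v) + (card T + card R)"
        proof -
          have "L = S1 v \<union> (T \<union> R)" by (auto simp: S1_def T_def R_def L_def)
          then show ?thesis by (metis card_Un_le add_left_mono le_trans)
        qed
        ultimately show ?thesis using card_link[OF finG, of v] del unfolding L_def g_def by linarith
      qed
      have "n * g = (\<Sum>v\<in>V. g)" by (simp add: n_def)
      also have "\<dots> \<le> (\<Sum>v\<in>V. C * n ^ 2 + (card (S1 v) + card (S2 v) + C0 * n))" by (intro sum_mono vert)
      also have "\<dots> = n * (C * n ^ 2) + (card (up_edges V G) + card (up_edges V Gc) + n * (C0 * n))"
        using fin finG Gc(2)
        by (simp add: sum.distrib n_def up_edges_def S1_def S2_def card_SigmaI link_def)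
      finally have 1: "n * g \<le> n * (C * n ^ 2) + (card (up_edges V G) + card (up_edges V Gc) + n * (C0 * n))" .
      have "3 * card (up_edges V G) \<le> 2 * g" unfolding g_def by (rule card_up_edges[OF fin G no])
      moreover have "3 * card (up_edges V Gc) \<le> 2 * g"
        using card_up_edges[OF fin Gc(1) noc] inj by (simp add: g_def Gc_def card_image)
      ultimately have 2: "3 * (n * g) \<le> 3 * (n * (C * n ^ 2)) + 4 * g + 3 * (n * (C0 * n))"
        using 1 by linarith
      obtain m where m: "n = m + 6" using n6 le_Suc_ex by (metis add.commute)
      have "(3 * m + 14) * g \<le> 3 * C * (m + 6) ^ 3 + 3 * C0 * (m + 6) ^ 2"
        using 2 unfolding m by (simp add: algebra_simps power2_eq_square power3_eq_cube)
      moreover have "(3 * m + 14) * (C * (m + 7) ^ 2) < (3 * m + 14) * g"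
      proof (intro mult_strict_left_mono)
        have "n + 1 = m + 7" by (simp add: m)
        then show "C * (m + 7) ^ 2 < g" using big by (simp only:)
      qed simp
      ultimately have "(3 * m + 14) * (C * (m + 7) ^ 2) < 3 * C * (m + 6) ^ 3 + 3 * C0 * (m + 6) ^ 2"
        by (rule less_le_trans[rotated])
      moreover have "3 * C0 * (m + 6) ^ 2 \<le> C * (m + 6) ^ 2" by (intro mult_le_mono1) (simp add: C_def)
      ultimately have "(3 * m + 14) * (C * (m + 7) ^ 2) < 3 * C * (m + 6) ^ 3 + C * (m + 6) ^ 2" by linarith
      then have "C * ((3 * m + 14) * (m + 7) ^ 2) < C * (3 * (m + 6) ^ 3 + (m + 6) ^ 2)"
        by (simp add: algebra_simps)
      then have "(3 * m + 14) * (m + 7) ^ 2 < 3 * (m + 6) ^ 3 + (m + 6) ^ 2" by simp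
      then show False by (simp add: algebra_simps power2_eq_square power3_eq_cube)
    qed
  qed
  then show ?thesis unfolding poly_bdd_def by blast
qed


section \<open>The theorem\<close>

lemma poly_bdd_Venn:
  assumes "k \<ge> 3"
  shows "poly_bdd (has_regions k (2 ^ k) :: 'a set \<Rightarrow> _) (2 ^ k - 2 * k + 1)"
  using assms
proof (induction k rule: dec_induct)
  case base
  have "poly_bdd (has_regions 3 (7 + 1) :: 'a set \<Rightarrow> _) (2 + 1)"
    by (rule poly_bdd_add_region[OF poly_bdd_three_sets]) simp
  then show ?case by simp
next
  case (step k)
  then show ?case by (intro poly_bdd_Venn_step)
qed

text \<open>
  The vertex \<open>A\<close> of the Venn diagram is sent to a point in the region of \<open>A\<close>. The edges of the diagram
  are numbered from \<open>1\<close> and the members of the tuple from \<open>0\<close>, hence the shift.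
\<close>

lemma contains_VD:
  assumes H: "hypergraph H" and reg: "has_regions k (2 ^ k) (verts H) (edges H)"
  shows "contains_trace H (VD k)"
proof -
  obtain E where E: "\<forall>i<k. E i \<in> edges H" and all: "label k E ` verts H = Pow {..<k}"
    using reg unfolding has_regions_def label_image_eq_Pow by blast
  define r where "r A = (SOME x. x \<in> verts H \<and> label k E x = {i. i < k \<and> Suc i \<in> A})" for A
  have r: "r A \<in> verts H" "label k E (r A) = {i. i < k \<and> Suc i \<in> A}" for A
  proof -
    have "{i. i < k \<and> Suc i \<in> A} \<in> label k E ` verts H" unfolding all by auto
    then have "\<exists>x. x \<in> verts H \<and> label k E x = {i. i < k \<and> Suc i \<in> A}" by auto
    then have "r A \<in> verts H \<and> label k E (r A) = {i. i < k \<and> Suc i \<in> A}"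
      unfolding r_def by (rule someI_ex)
    then show "r A \<in> verts H" "label k E (r A) = {i. i < k \<and> Suc i \<in> A}" by auto
  qed
  have mem: "r A \<in> E i \<longleftrightarrow> Suc i \<in> A" if "i < k" for i A
    using r(2)[of A] that by (auto simp: label_def)
  define S where "S = r ` Pow {1..k}"
  define G where "G = (S, {E i \<inter> S | i. i < k})"
  have S: "S \<subseteq> verts H" using r by (auto simp: S_def)
  have fin: "finite S" by (simp add: S_def)
  have inj: "inj_on r (Pow {1..k})"
  proof (rule inj_onI)
    fix A B assume AB: "A \<in> Pow {1..k}" "B \<in> Pow {1..k}" and eq: "r A = r B"
    have "j \<in> A \<longleftrightarrow> j \<in> B" if "j \<in> {1..k}" for j
      using mem[of "j - 1" A] mem[of "j - 1" B] that eq by auto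
    then show "A = B" using AB by blast
  qed
  have edge: "r ` {A. A \<subseteq> {1..k} \<and> j \<in> A} = E (j - 1) \<inter> S" if "j \<in> {1..k}" for j
    using mem[of "j - 1"] that by (auto simp: S_def)
  have "hypergraph_iso (VD k) G"
    unfolding hypergraph_iso_def
  proof (intro exI[of _ r] conjI)
    show "bij_betw r (verts (VD k)) (verts G)" using inj by (simp add: bij_betw_def VD_def G_def S_def)
    have "(\<lambda>E. r ` E) ` edges (VD k) = (\<lambda>j. r ` {A. A \<subseteq> {1..k} \<and> j \<in> A}) ` {1..k}"
    proof -
      have "edges (VD k) = (\<lambda>j. {A. A \<subseteq> {1..k} \<and> j \<in> A}) ` {1..k}" by (auto simp: VD_def)
      then show ?thesis by (simp only: image_image)
    qed
    also have "\<dots> = (\<lambda>j. E (j - 1) \<inter> S) ` {1..k}" using edge by (intro image_cong refl)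
    also have "\<dots> = (\<lambda>i. E i \<inter> S) ` (\<lambda>j. j - 1) ` {1..k}" by (simp add: image_image)
    also have "(\<lambda>j. j - 1) ` {1..k} = {..<k}"
      by (auto simp: image_iff intro!: bexI[of _ "Suc _"])
    finally show "edges G = (\<lambda>E. r ` E) ` edges (VD k)" by (auto simp: G_def)
  qed
  moreover have "subhypergraph G (trace H S)"
    using E fin by (auto simp: subhypergraph_def hypergraph_def trace_def G_def)
  ultimately show ?thesis unfolding contains_trace_def using S by blast
qed

lemma edges_bound:
  assumes "k \<ge> 3"
  obtains C :: real where "C \<ge> 0" "\<And>H :: 'a hypergraph. hypergraph H \<Longrightarrow> card (verts H) \<ge> 1 \<Longrightarrow>
    \<not> contains_trace H (VD k) \<Longrightarrow> real (card (edges H)) \<le> C * real (card (verts H)) ^ (2 ^ k - 2 * k + 1)"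
proof -
  define d :: nat where "d = 2 ^ k - 2 * k + 1"
  obtain C where C: "\<And>V H :: 'a set set. finite V \<Longrightarrow> H \<subseteq> Pow V \<Longrightarrow> \<not> has_regions k (2 ^ k) V H \<Longrightarrow>
      card H \<le> C * (card V + 1) ^ d"
    using poly_bdd_Venn[OF assms] unfolding poly_bdd_def d_def by blast
  have "real (card (edges H)) \<le> real (C * 2 ^ d) * real (card (verts H)) ^ d"
    if H: "hypergraph H" "card (verts H) \<ge> 1" "\<not> contains_trace H (VD k)" for H :: "'a hypergraph"
  proof -
    have "\<not> has_regions k (2 ^ k) (verts H) (edges H)" using contains_VD[OF H(1)] H(3) by blast
    then have "card (edges H) \<le> C * (card (verts H) + 1) ^ d"
      using H(1) by (intro C) (auto simp: hypergraph_def)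
    also have "\<dots> \<le> C * (2 * card (verts H)) ^ d" using H(2) by (intro mult_le_mono2 power_mono) auto
    also have "\<dots> = C * 2 ^ d * card (verts H) ^ d" by (simp only: power_mult_distrib mult.assoc)
    finally have "real (card (edges H)) \<le> real (C * 2 ^ d * card (verts H) ^ d)" by (rule of_nat_mono)
    then show ?thesis by simp
  qed
  then show ?thesis by (intro that[of "real (C * 2 ^ d)"]) (auto simp: d_def)
qed

theorem theorem1p1:
  fixes k :: nat
  assumes "k \<ge> 3"
  shows "(\<lambda>n. real (ex_tr n (VD k))) \<in> O(\<lambda>n. real n ^ (2 ^ k - 2 * k + 1)) \<and>
    (\<exists>C::real. \<forall>n\<ge>1. \<forall>H :: 'a hypergraph.
       hypergraph H \<and> card (verts H) = n \<and> \<not> contains_trace H (VD k) \<longrightarrow>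
       real (card (edges H)) \<le> C * real n ^ (2 ^ k - 2 * k + 1))"
proof
  define d :: nat where "d = 2 ^ k - 2 * k + 1"
  obtain C :: real where C: "C \<ge> 0" "\<And>H :: nat hypergraph. hypergraph H \<Longrightarrow> card (verts H) \<ge> 1 \<Longrightarrow>
    \<not> contains_trace H (VD k) \<Longrightarrow> real (card (edges H)) \<le> C * real (card (verts H)) ^ d"
    using edges_bound[OF assms] unfolding d_def by blast
  have ex: "real (ex_tr n (VD k)) \<le> C * real n ^ d" if n: "n \<ge> 1" for n
  proof -
    define M where "M = {card (edges H) | H :: nat hypergraph.
      hypergraph H \<and> card (verts H) = n \<and> \<not> contains_trace H (VD k)}"
    have "M \<subseteq> {..2 ^ n}"
    proof
      fix m assume "m \<in> M"
      then obtain H :: "nat hypergraph" where H: "m = card (edges H)" "hypergraph H" "card (verts H) = n"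
        by (auto simp: M_def)
      then have "m \<le> card (Pow (verts H))" unfolding H(1) hypergraph_def by (intro card_mono) auto
      then show "m \<in> {..2 ^ n}" using H by (simp add: card_Pow hypergraph_def)
    qed
    then have "finite M" using finite_subset by blast
    moreover have "0 \<in> M"
    proof -
      \<comment> \<open>the edgeless hypergraph shows that the maximum ranges over a nonempty set\<close>
      define H0 :: "nat hypergraph" where "H0 = ({..<n}, {})"
      have "\<not> contains_trace H0 (VD k)"
      proof
        assume "contains_trace H0 (VD k)"
        then have "edges (VD k) = {}"
          by (auto simp: contains_trace_def subhypergraph_def trace_def hypergraph_iso_def H0_def)
        then show False using assms by (auto simp: VD_def)
      qed
      moreover have "hypergraph H0" "card (verts H0) = n" "0 = card (edges H0)"
        by (simp_all add: H0_def hypergraph_def)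
      ultimately show ?thesis unfolding M_def by blast
    qed
    ultimately have "ex_tr n (VD k) \<in> M" unfolding ex_tr_def M_def[symmetric] by (intro Max_in) auto
    then obtain H :: "nat hypergraph" where "ex_tr n (VD k) = card (edges H)" "hypergraph H"
        "card (verts H) = n" "\<not> contains_trace H (VD k)"
      by (auto simp: M_def)
    then show ?thesis using C(2)[of H] n by simp
  qed
  show "(\<lambda>n. real (ex_tr n (VD k))) \<in> O(\<lambda>n. real n ^ (2 ^ k - 2 * k + 1))"
    unfolding d_def[symmetric]
    by (rule bigoI[where c = C]) (use ex in \<open>auto intro!: eventually_at_top_linorderI[of 1]\<close>)
  obtain C' :: real where "\<And>H :: 'a hypergraph. hypergraph H \<Longrightarrow> card (verts H) \<ge> 1 \<Longrightarrow>
    \<not> contains_trace H (VD k) \<Longrightarrow> real (card (edges H)) \<le> C' * real (card (verts H)) ^ (2 ^ k - 2 * k + 1)"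
    using edges_bound[OF assms] by blast
  then show "\<exists>C::real. \<forall>n\<ge>1. \<forall>H :: 'a hypergraph.
       hypergraph H \<and> card (verts H) = n \<and> \<not> contains_trace H (VD k) \<longrightarrow>
       real (card (edges H)) \<le> C * real n ^ (2 ^ k - 2 * k + 1)"
    by (intro exI[of _ C']) blast
qed

end
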